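(* Let $d\geq 3$ be an integer and let $\zeta,\zeta^{*},\zeta^{\varepsilon}\in\mathbb{K}$. Then the following (i), (ii) are equivalent. (i) There exists a totally bipartite Leonard triple $A,A^{*},A^{\varepsilon}$ of Bannai/Ito type with diameter $d$ that satisfies $$\zeta^{\varepsilon}(AA^{*}+A^{*}A)=A^{\varepsilon},\qquad \zeta(A^{*}A^{\varepsilon}+A^{\varepsilon}A^{*})=A,\qquad \zeta^{*}(A^{\varepsilon}A+AA^{\varepsilon})=A^{*}.$$ (ii) The integer $d$ is even and the scalars $\zeta,\zeta^{*},\zeta^{\varepsilon}$ are nonzero. Moreover, if (i), (ii) hold, then the Leonard triple in (i) is unique up to isomorphism of Leonard triples.
   Context: $\mathbb{K}$ is an algebraically closed field of characteristic zero. A square matrix is tridiagonal if every nonzero entry lies on the diagonal, subdiagonal or superdiagonal; a tridiagonal matrix is irreducible if every subdiagonal and superdiagonal entry is nonzero. A tridiagonal matrix $B$ with rows and columns indexed by $0,\dots,d$ is bipartite if $B_{ii}=0$ for all $i$. Let $V$ be a $\mathbb{K}$-vector space of finite positive dimension. A Leonard pair on $V$ is an ordered pair of linear maps $A,A^*:V\to V$ such that there is a basis $\{v_i\}_{i=0}^d$ of $V$ in which $A$ is diagonal and $A^*$ is irreducible tridiagonal, and a basis $\{v^*_i\}_{i=0}^d$ in which $A^*$ is diagonal and $A$ is irreducible tridiagonal. With $\theta_i$ the eigenvalue of $A$ for $v_i$ and $\theta_i^*$ the eigenvalue of $A^*$ for $v_i^*$, it is known that the expressions $\frac{\theta_{i-2}-\theta_{i+1}}{\theta_{i-1}-\theta_i}$,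 $\frac{\theta^*_{i-2}-\theta^*_{i+1}}{\theta^*_{i-1}-\theta^*_i}$ are equal and independent of $i$ for $2\le i\le d-1$; the Leonard pair is of Bannai/Ito type if this common value is $-1$. A Leonard triple on $V$ is an ordered triple of linear maps $A,A^*,A^\varepsilon:V\to V$ such that for each of the three maps there is a basis of $V$ in which that map is diagonal and the other two are irreducible tridiagonal. Its diameter is $\dim V-1$. It is totally bipartite if all six tridiagonal matrices so arising are bipartite. Any two of the three maps (in either order) form a Leonard pair; the triple is of Bannai/Ito type if all these Leonard pairs are. Leonard triples $A,A^*,A^\varepsilon$ on $V$ and $B,B^*,B^\varepsilon$ on $W$ are isomorphic if there is a vector space isomorphism $\phi:V\to W$ with $\phi A=B\phi$, $\phi A^*=B^*\phi$, $\phi A^\varepsilon=B^\varepsilon\phi$. *)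

theory Defs
  imports
    Complex_Main
    "HOL-Computational_Algebra.Computational_Algebra"
    "HOL-Library.Function_Algebras"
begin

text \<open>
  A vector space over \<open>'k\<close> is a subspace \<open>V\<close> of an ambient vector space given by a type
  \<open>'v\<close> and a scalar multiplication \<open>s\<close>; this allows one to quantify over vector spaces of
  every dimension. A linear map \<open>V \<rightarrow> W\<close> is a HOL function of which only the values on
  \<open>V\<close> matter, so that equalities of linear maps are always stated pointwise on \<open>V\<close>.
\<close>

definition fin_dim_space :: "('k::field \<Rightarrow> 'v::ab_group_add \<Rightarrow> 'v) \<Rightarrow> 'v set \<Rightarrow> bool" where
  "fin_dim_space s V \<longleftrightarrow>
     vector_space s \<and> module.subspace s V \<and> V \<noteq> {0} \<and>
     (\<exists>B. finite B \<and> module.span s B = V)"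

definition linear_map ::
  "('k::field \<Rightarrow> 'v::ab_group_add \<Rightarrow> 'v) \<Rightarrow> ('k \<Rightarrow> 'w::ab_group_add \<Rightarrow> 'w) \<Rightarrow>
    'v set \<Rightarrow> 'w set \<Rightarrow> ('v \<Rightarrow> 'w) \<Rightarrow> bool" where
  "linear_map s t V W f \<longleftrightarrow>
     (\<forall>x\<in>V. f x \<in> W) \<and>
     (\<forall>x\<in>V. \<forall>y\<in>V. f (x + y) = f x + f y) \<and>
     (\<forall>c. \<forall>x\<in>V. f (s c x) = t c (f x))"

definition diameter :: "('k::field \<Rightarrow> 'v::ab_group_add \<Rightarrow> 'v) \<Rightarrow> 'v set \<Rightarrow> nat" where
  "diameter s V = vector_space.dim s V - 1"

definition is_basis ::
  "('k::field \<Rightarrow> 'v::ab_group_add \<Rightarrow> 'v) \<Rightarrow> 'v set \<Rightarrow> nat \<Rightarrow> (nat \<Rightarrow> 'v) \<Rightarrow> bool" where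
  "is_basis s V d v \<longleftrightarrow>
     inj_on v {..d} \<and> \<not> module.dependent s (v ` {..d}) \<and> module.span s (v ` {..d}) = V"

text \<open>
  A square matrix with rows and columns indexed by \<open>0, \<dots>, d\<close> is a function \<open>B\<close> of which only
  the entries \<open>B i j\<close> with \<open>i, j \<le> d\<close> matter. With respect to a basis
  \<open>v 0, \<dots>, v d\<close>, the coordinates of \<open>A (v j)\<close> form column \<open>j\<close> of the matrix representing \<open>A\<close>.
\<close>

definition represents ::
  "('k::field \<Rightarrow> 'v::ab_group_add \<Rightarrow> 'v) \<Rightarrow> nat \<Rightarrow> (nat \<Rightarrow> 'v) \<Rightarrow> ('v \<Rightarrow> 'v) \<Rightarrow>
    (nat \<Rightarrow> nat \<Rightarrow> 'k) \<Rightarrow> bool" where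
  "represents s d v A B \<longleftrightarrow> (\<forall>j\<le>d. A (v j) = (\<Sum>i\<le>d. s (B i j) (v i)))"

definition diagonal :: "nat \<Rightarrow> (nat \<Rightarrow> nat \<Rightarrow> 'k::zero) \<Rightarrow> bool" where
  "diagonal d B \<longleftrightarrow> (\<forall>i\<le>d. \<forall>j\<le>d. B i j \<noteq> 0 \<longrightarrow> i = j)"

definition tridiagonal :: "nat \<Rightarrow> (nat \<Rightarrow> nat \<Rightarrow> 'k::zero) \<Rightarrow> bool" where
  "tridiagonal d B \<longleftrightarrow>
     (\<forall>i\<le>d. \<forall>j\<le>d. B i j \<noteq> 0 \<longrightarrow> i = j \<or> i = Suc j \<or> j = Suc i)"

definition irreducible_tridiagonal :: "nat \<Rightarrow> (nat \<Rightarrow> nat \<Rightarrow> 'k::zero) \<Rightarrow> bool" where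
  "irreducible_tridiagonal d B \<longleftrightarrow>
     tridiagonal d B \<and> (\<forall>i<d. B (Suc i) i \<noteq> 0 \<and> B i (Suc i) \<noteq> 0)"

definition bipartite :: "nat \<Rightarrow> (nat \<Rightarrow> nat \<Rightarrow> 'k::zero) \<Rightarrow> bool" where
  "bipartite d B \<longleftrightarrow> tridiagonal d B \<and> (\<forall>i\<le>d. B i i = 0)"

text \<open>
  \<open>standard_basis s V A S v\<close>: in the basis \<open>v\<close> of \<open>V\<close> the map \<open>A\<close> is diagonal and every map
  in \<open>S\<close> is irreducible tridiagonal.
\<close>

definition standard_basis ::
  "('k::field \<Rightarrow> 'v::ab_group_add \<Rightarrow> 'v) \<Rightarrow> 'v set \<Rightarrow> ('v \<Rightarrow> 'v) \<Rightarrow> ('v \<Rightarrow> 'v) set \<Rightarrow>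
    (nat \<Rightarrow> 'v) \<Rightarrow> bool" where
  "standard_basis s V A S v \<longleftrightarrow>
     is_basis s V (diameter s V) v \<and>
     (\<exists>D. represents s (diameter s V) v A D \<and> diagonal (diameter s V) D) \<and>
     (\<forall>X\<in>S. \<exists>B. represents s (diameter s V) v X B \<and>
        irreducible_tridiagonal (diameter s V) B)"

definition leonard_pair ::
  "('k::field \<Rightarrow> 'v::ab_group_add \<Rightarrow> 'v) \<Rightarrow> 'v set \<Rightarrow> ('v \<Rightarrow> 'v) \<Rightarrow> ('v \<Rightarrow> 'v) \<Rightarrow> bool" where
  "leonard_pair s V A As \<longleftrightarrow>
     fin_dim_space s V \<and> linear_map s s V V A \<and> linear_map s s V V As \<and>
     (\<exists>v. standard_basis s V A {As} v) \<and>
     (\<exists>v. standard_basis s V As {A} v)"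

definition eigenvalues ::
  "('k::field \<Rightarrow> 'v::ab_group_add \<Rightarrow> 'v) \<Rightarrow> nat \<Rightarrow> (nat \<Rightarrow> 'v) \<Rightarrow> ('v \<Rightarrow> 'v) \<Rightarrow>
    (nat \<Rightarrow> 'k) \<Rightarrow> bool" where
  "eigenvalues s d v A \<theta> \<longleftrightarrow> (\<forall>i\<le>d. A (v i) = s (\<theta> i) (v i))"

text \<open>
  The bases in the definition of a Leonard pair are unique up to rescaling the vectors and
  reversing their order, and the ratio below is invariant under both. Quantifying over all such
  bases is therefore only a matter of not choosing one. For diameter less than \<open>3\<close> there is no
  ratio, hence no common value.
\<close>

definition leonard_pair_bannai_ito ::
  "('k::field \<Rightarrow> 'v::ab_group_add \<Rightarrow> 'v) \<Rightarrow> 'v set \<Rightarrow> ('v \<Rightarrow> 'v) \<Rightarrow> ('v \<Rightarrow> 'v) \<Rightarrow> bool" where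
  "leonard_pair_bannai_ito s V A As \<longleftrightarrow>
     leonard_pair s V A As \<and> 3 \<le> diameter s V \<and>
     (\<forall>v vs \<theta> \<theta>s.
        standard_basis s V A {As} v \<and> eigenvalues s (diameter s V) v A \<theta> \<and>
        standard_basis s V As {A} vs \<and> eigenvalues s (diameter s V) vs As \<theta>s \<longrightarrow>
        (\<forall>i\<in>{2..diameter s V - 1}.
           (\<theta> (i - 2) - \<theta> (i + 1)) / (\<theta> (i - 1) - \<theta> i) = - 1 \<and>
           (\<theta>s (i - 2) - \<theta>s (i + 1)) / (\<theta>s (i - 1) - \<theta>s i) = - 1))"

definition leonard_triple ::
  "('k::field \<Rightarrow> 'v::ab_group_add \<Rightarrow> 'v) \<Rightarrow> 'v set \<Rightarrow>
    ('v \<Rightarrow> 'v) \<Rightarrow> ('v \<Rightarrow> 'v) \<Rightarrow> ('v \<Rightarrow> 'v) \<Rightarrow> bool" where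
  "leonard_triple s V A As Ae \<longleftrightarrow>
     fin_dim_space s V \<and>
     linear_map s s V V A \<and> linear_map s s V V As \<and> linear_map s s V V Ae \<and>
     (\<exists>v. standard_basis s V A {As, Ae} v) \<and>
     (\<exists>v. standard_basis s V As {Ae, A} v) \<and>
     (\<exists>v. standard_basis s V Ae {A, As} v)"

text \<open>
  Again the bases are unique up to rescaling and order reversal, so the quantification over all of
  them in the next definition involves no choice.
\<close>

definition bipartite_in_standard_bases ::
  "('k::field \<Rightarrow> 'v::ab_group_add \<Rightarrow> 'v) \<Rightarrow> 'v set \<Rightarrow> ('v \<Rightarrow> 'v) \<Rightarrow> ('v \<Rightarrow> 'v) set \<Rightarrow> bool"
where
  "bipartite_in_standard_bases s V A S \<longleftrightarrow>
     (\<forall>v. standard_basis s V A S v \<longrightarrow>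
        (\<forall>X\<in>S. \<forall>B. represents s (diameter s V) v X B \<longrightarrow> bipartite (diameter s V) B))"

definition totally_bipartite_leonard_triple ::
  "('k::field \<Rightarrow> 'v::ab_group_add \<Rightarrow> 'v) \<Rightarrow> 'v set \<Rightarrow>
    ('v \<Rightarrow> 'v) \<Rightarrow> ('v \<Rightarrow> 'v) \<Rightarrow> ('v \<Rightarrow> 'v) \<Rightarrow> bool" where
  "totally_bipartite_leonard_triple s V A As Ae \<longleftrightarrow>
     leonard_triple s V A As Ae \<and>
     bipartite_in_standard_bases s V A {As, Ae} \<and>
     bipartite_in_standard_bases s V As {Ae, A} \<and>
     bipartite_in_standard_bases s V Ae {A, As}"

definition leonard_triple_bannai_ito ::
  "('k::field \<Rightarrow> 'v::ab_group_add \<Rightarrow> 'v) \<Rightarrow> 'v set \<Rightarrow>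
    ('v \<Rightarrow> 'v) \<Rightarrow> ('v \<Rightarrow> 'v) \<Rightarrow> ('v \<Rightarrow> 'v) \<Rightarrow> bool" where
  "leonard_triple_bannai_ito s V A As Ae \<longleftrightarrow>
     leonard_triple s V A As Ae \<and>
     leonard_pair_bannai_ito s V A As \<and> leonard_pair_bannai_ito s V As A \<and>
     leonard_pair_bannai_ito s V As Ae \<and> leonard_pair_bannai_ito s V Ae As \<and>
     leonard_pair_bannai_ito s V Ae A \<and> leonard_pair_bannai_ito s V A Ae"

definition leonard_triple_iso ::
  "('k::field \<Rightarrow> 'v::ab_group_add \<Rightarrow> 'v) \<Rightarrow> 'v set \<Rightarrow>
    ('v \<Rightarrow> 'v) \<Rightarrow> ('v \<Rightarrow> 'v) \<Rightarrow> ('v \<Rightarrow> 'v) \<Rightarrow>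
    ('k \<Rightarrow> 'w::ab_group_add \<Rightarrow> 'w) \<Rightarrow> 'w set \<Rightarrow>
    ('w \<Rightarrow> 'w) \<Rightarrow> ('w \<Rightarrow> 'w) \<Rightarrow> ('w \<Rightarrow> 'w) \<Rightarrow> bool" where
  "leonard_triple_iso s V A As Ae t W B Bs Be \<longleftrightarrow>
     (\<exists>\<phi>. linear_map s t V W \<phi> \<and> bij_betw \<phi> V W \<and>
        (\<forall>x\<in>V. \<phi> (A x) = B (\<phi> x) \<and> \<phi> (As x) = Bs (\<phi> x) \<and> \<phi> (Ae x) = Be (\<phi> x)))"

definition anticommutator_relations ::
  "('k::field \<Rightarrow> 'v::ab_group_add \<Rightarrow> 'v) \<Rightarrow> 'v set \<Rightarrow> 'k \<Rightarrow> 'k \<Rightarrow> 'k \<Rightarrow>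
    ('v \<Rightarrow> 'v) \<Rightarrow> ('v \<Rightarrow> 'v) \<Rightarrow> ('v \<Rightarrow> 'v) \<Rightarrow> bool" where
  "anticommutator_relations s V \<zeta> \<zeta>s \<zeta>e A As Ae \<longleftrightarrow>
     (\<forall>x\<in>V. s \<zeta>e (A (As x) + As (A x)) = Ae x \<and>
            s \<zeta> (As (Ae x) + Ae (As x)) = A x \<and>
            s \<zeta>s (Ae (A x) + A (Ae x)) = As x)"

text \<open>
  The space of sequences, as an ambient space: every finite-dimensional vector space over \<open>'k\<close> is
  isomorphic to a subspace of it.
\<close>

definition seq_scale :: "'k::field \<Rightarrow> (nat \<Rightarrow> 'k) \<Rightarrow> (nat \<Rightarrow> 'k)" where
  "seq_scale c f = (\<lambda>i. c * f i)"

end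

theory Submission
  imports Defs
begin

text \<open>
  In a basis that diagonalises \<open>A\<close> with eigenvalues \<open>\<theta>\<^sub>i\<close>, the first relation gives the entries of
  \<open>Ae\<close> as \<open>\<zeta>e (\<theta>\<^sub>i + \<theta>\<^sub>j)\<close> times those of \<open>As\<close>, and the third then forces
  \<open>\<zeta>s \<zeta>e (\<theta>\<^sub>i + \<theta>\<^sub>i\<^sub>+\<^sub>1)\<^sup>2 = 1\<close>. Since \<open>A\<close> is irreducible tridiagonal in another basis, its eigenvalues
  are distinct, so the sums \<open>\<theta>\<^sub>i + \<theta>\<^sub>i\<^sub>+\<^sub>1\<close> alternate in sign and
  \<open>\<theta>\<^sub>i = (-1)\<^sup>i (\<theta>\<^sub>0 - i c)\<close>. The diagonal of the second relation is a telescoping recurrence for the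
  products of opposite off-diagonal entries of \<open>As\<close>; its two boundary conditions give
  \<open>\<theta>\<^sub>0 = d c / 2\<close>, which for odd \<open>d\<close> would make \<open>\<theta>\<^sub>0 = \<theta>\<^sub>d\<close>. All parameters are now known up to the sign
  of \<open>c\<close>, which is reversed by reversing the basis; this is uniqueness.

  For existence, the same matrices define maps that satisfy the relations. On an eigenvector of \<open>As\<close>
  the operators \<open>A \<plusminus> k Ae\<close>, for a suitable \<open>k\<close>, act as ladder operators, and applying them alternately
  to an extremal eigenvector produces an eigenbasis of \<open>As\<close> in which \<open>A\<close> and \<open>Ae\<close> are irreducible
  tridiagonal. As the relations are invariant under cyclic permutations, this also handles the
  eigenbases of \<open>Ae\<close> and \<open>A\<close>.
\<close>

section \<open>Bases and matrices\<close>

context vector_space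
begin

section \<open>Indexed bases and coefficient functions\<close>

lemma linear_map_sum:
  assumes "linear_map scale t V W f" "subspace V" "vector_space t"
    and "\<And>i. i \<in> I \<Longrightarrow> v i \<in> V"
  shows "f (\<Sum>i\<in>I. a i *s v i) = (\<Sum>i\<in>I. t (a i) (f (v i)))"
proof -
  interpret T: vector_space t by fact
  have f0: "f 0 = 0"
    using assms(1) subspace_0[OF assms(2)] unfolding linear_map_def
    by (metis T.scale_zero_left scale_zero_left)
  show ?thesis
    using assms(4)
  proof (induction I rule: infinite_finite_induct)
    case (insert i I)
    have "(\<Sum>i\<in>I. a i *s v i) \<in> V"
      using insert.prems by (intro subspace_sum subspace_scale assms(2)) auto
    moreover have "a i *s v i \<in> V"
      using insert.prems by (intro subspace_scale assms(2)) auto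
    ultimately show ?case
      using insert assms(1) unfolding linear_map_def by simp
  qed (simp_all add: f0)
qed

text \<open>A repeated vector already gives the nontrivial relation \<open>v i - v j = 0\<close>, so
  injectivity and independence of the image set merge into one condition on coefficients.\<close>

lemma independent_family_iff:
  fixes v :: "nat \<Rightarrow> 'b"
  shows "inj_on v {..n} \<and> independent (v ` {..n}) \<longleftrightarrow>
    (\<forall>a. (\<Sum>i\<le>n. a i *s v i) = 0 \<longrightarrow> (\<forall>i\<le>n. a i = 0))"
proof (intro iffI conjI)
  assume *: "inj_on v {..n} \<and> independent (v ` {..n})"
  show "\<forall>a. (\<Sum>i\<le>n. a i *s v i) = 0 \<longrightarrow> (\<forall>i\<le>n. a i = 0)"
  proof (intro allI impI)
    fix a i assume s: "(\<Sum>i\<le>n. a i *s v i) = 0" and i: "i \<le> n"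
    have "(\<Sum>x\<in>v ` {..n}. a (the_inv_into {..n} v x) *s x) = (\<Sum>i\<le>n. a i *s v i)"
      using * by (subst sum.reindex) (auto simp: the_inv_into_f_f intro!: sum.cong)
    then have "a (the_inv_into {..n} v (v i)) = 0"
      using * s i by (intro independentD[of "v ` {..n}" "v ` {..n}" "\<lambda>x. a (the_inv_into {..n} v x)"]) auto
    then show "a i = 0" using * i by (simp add: the_inv_into_f_f)
  qed
next
  assume *: "\<forall>a. (\<Sum>i\<le>n. a i *s v i) = 0 \<longrightarrow> (\<forall>i\<le>n. a i = 0)"
  show inj: "inj_on v {..n}"
  proof (rule inj_onI, rule ccontr)
    fix i j assume ij: "i \<in> {..n}" "j \<in> {..n}" "v i = v j" "i \<noteq> j"
    define a where "a l = (if l = i then 1 else 0) - (if l = j then 1 else (0 :: 'a))" for l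
    have "(\<Sum>l\<le>n. a l *s v l) = v i - v j"
      using ij by (simp add: a_def scale_left_diff_distrib sum_subtractf if_distrib[of "\<lambda>c. c *s _"]
          sum.delta cong: if_cong)
    then have "a i = 0" using * ij by auto
    then show False using ij by (simp add: a_def)
  qed
  show "independent (v ` {..n})"
  proof
    assume "dependent (v ` {..n})"
    then obtain u where u: "\<exists>x\<in>v ` {..n}. u x \<noteq> 0" "(\<Sum>x\<in>v ` {..n}. u x *s x) = 0"
      using dependent_finite[of "v ` {..n}"] by auto
    have "(\<Sum>i\<le>n. u (v i) *s v i) = 0"
      using u(2) inj by (simp add: sum.reindex)
    then have "\<forall>i\<le>n. u (v i) = 0"
      using *[THEN spec, of "\<lambda>i. u (v i)"] by auto
    then show False using u(1) by auto
  qed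
qed

lemma span_family:
  fixes v :: "nat \<Rightarrow> 'b"
  assumes "inj_on v {..n}"
  shows "span (v ` {..n}) = range (\<lambda>a. \<Sum>i\<le>n. a i *s v i)"
proof -
  have "(\<Sum>i\<le>n. a i *s v i) \<in> span (v ` {..n})" for a
    by (intro span_sum span_scale span_base) auto
  moreover have "\<exists>a. x = (\<Sum>i\<le>n. a i *s v i)" if x: "x \<in> span (v ` {..n})" for x
  proof -
    obtain u where "x = (\<Sum>y\<in>v ` {..n}. u y *s y)"
      using x by (auto simp: span_finite)
    then have "x = (\<Sum>i\<le>n. u (v i) *s v i)"
      using assms by (simp add: sum.reindex)
    then show ?thesis by (rule exI[of _ "\<lambda>i. u (v i)"])
  qed
  ultimately show ?thesis by (auto simp: image_iff)
qed

lemma is_basis_iff: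
  "is_basis scale V n v \<longleftrightarrow>
    (\<forall>a. (\<Sum>i\<le>n. a i *s v i) = 0 \<longrightarrow> (\<forall>i\<le>n. a i = 0)) \<and>
    V = range (\<lambda>a. \<Sum>i\<le>n. a i *s v i)"
  unfolding is_basis_def using independent_family_iff[of v n] span_family[of v n] by blast

lemma is_basis_mem:
  assumes "is_basis scale V n v" "i \<le> n"
  shows "v i \<in> V"
  using assms span_base[of "v i" "v ` {..n}"] by (auto simp: is_basis_def)

lemma is_basis_nonzero:
  assumes "is_basis scale V n v" "i \<le> n"
  shows "v i \<noteq> 0"
  using assms dependent_zero[of "v ` {..n}"] by (force simp: is_basis_def)

lemma is_basis_unique:
  assumes "is_basis scale V n v" "(\<Sum>i\<le>n. a i *s v i) = (\<Sum>i\<le>n. b i *s v i)" "i \<le> n"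
  shows "a i = b i"
proof -
  have "(\<Sum>i\<le>n. (a i - b i) *s v i) = 0"
    using assms(2) by (simp add: scale_left_diff_distrib sum_subtractf)
  then have "a i - b i = 0"
    using assms(1,3) unfolding is_basis_iff by (auto dest!: spec[of _ "\<lambda>i. a i - b i"])
  then show ?thesis by simp
qed

lemma is_basis_expand:
  assumes "is_basis scale V n v" "x \<in> V"
  obtains a where "x = (\<Sum>i\<le>n. a i *s v i)"
  using assms unfolding is_basis_iff by auto

lemma is_basis_subspace:
  assumes "is_basis scale V n v"
  shows "subspace V"
  using assms subspace_span[of "v ` {..n}"] unfolding is_basis_def by simp

lemma is_basis_diameter:
  assumes "is_basis scale V n v"
  shows "diameter scale V = n"
proof -
  have "dim V = card (v ` {..n})"
    using assms unfolding is_basis_def by (metis dim_span_eq_card_independent)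
  also have "\<dots> = Suc n" using assms by (simp add: is_basis_def card_image)
  finally show ?thesis by (simp add: diameter_def)
qed

lemma is_basis_fin_dim_space:
  assumes "is_basis scale V n v"
  shows "fin_dim_space scale V"
proof -
  have "V \<noteq> {0}"
    using is_basis_nonzero[OF assms, of 0] is_basis_mem[OF assms, of 0] by auto
  moreover have "\<exists>B. finite B \<and> span B = V"
    using assms unfolding is_basis_def by (metis finite_atMost finite_imageI)
  ultimately show ?thesis
    using is_basis_subspace[OF assms] vector_space_axioms unfolding fin_dim_space_def by blast
qed

text \<open>Steinitz bound; it later forces a chain of eigenvectors with distinct eigenvalues to
  stop.\<close>

lemma no_longer_independent_family:
  assumes "is_basis scale V n v" and "\<And>i. i \<le> m \<Longrightarrow> w i \<in> V"
    and "\<And>a. (\<Sum>i\<le>m. a i *s w i) = 0 \<Longrightarrow> \<forall>i\<le>m. a i = 0"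
  shows "m \<le> n"
proof -
  have w: "inj_on w {..m}" "independent (w ` {..m})"
    using independent_family_iff[of w m] assms(3) by blast+
  have "w ` {..m} \<subseteq> span (v ` {..n})"
    using assms(1,2) by (auto simp: is_basis_def)
  then have "card (w ` {..m}) \<le> card (v ` {..n})"
    using independent_span_bound[OF _ w(2)] by blast
  also have "card (w ` {..m}) = Suc m"
    using w(1) by (simp add: card_image)
  also have "card (v ` {..n}) \<le> Suc n"
    by (metis card_atMost card_image_le finite_atMost)
  finally show ?thesis by simp
qed

lemma is_basis_if_independent_family:
  assumes v: "is_basis scale V n v" and w: "\<And>i. i \<le> n \<Longrightarrow> w i \<in> V"
    and ind: "\<And>a. (\<Sum>i\<le>n. a i *s w i) = 0 \<Longrightarrow> \<forall>i\<le>n. a i = 0"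
  shows "is_basis scale V n w"
proof -
  have w': "inj_on w {..n}" "independent (w ` {..n})"
    using independent_family_iff[of w n] ind by blast+
  have "V \<subseteq> span (w ` {..n})"
  proof (rule subsetI, rule ccontr)
    fix x assume x: "x \<in> V" "x \<notin> span (w ` {..n})"
    have "independent (insert x (w ` {..n}))"
      using w'(2) x(2) by (rule independent_insertI[rotated])
    moreover have "insert x (w ` {..n}) \<subseteq> span (v ` {..n})"
      using v w x by (auto simp: is_basis_def)
    ultimately have "card (insert x (w ` {..n})) \<le> card (v ` {..n})"
      using independent_span_bound by blast
    moreover have "card (insert x (w ` {..n})) = Suc (Suc n)"
      using w'(1) x(2) span_base[of x "w ` {..n}"] by (subst card_insert_disjoint) (auto simp: card_image)
    moreover have "card (v ` {..n}) \<le> Suc n"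
      by (metis card_atMost card_image_le finite_atMost)
    ultimately show False by simp
  qed
  moreover have "span (w ` {..n}) \<subseteq> V"
    using w by (intro span_minimal is_basis_subspace[OF v]) auto
  ultimately show ?thesis using w' by (auto simp: is_basis_def)
qed

text \<open>Applying \<open>A\<close> to a relation and subtracting \<open>\<theta> (Suc n)\<close>
  times the relation removes the last vector and multiplies the other coefficients by nonzero
  differences.\<close>

lemma eigenvectors_independent:
  fixes w :: "nat \<Rightarrow> 'b"
  assumes A: "linear_map scale scale V V A" "subspace V"
    and w: "\<And>i. i \<le> n \<Longrightarrow> w i \<in> V" "\<And>i. i \<le> n \<Longrightarrow> w i \<noteq> 0"
    and eig: "\<And>i. i \<le> n \<Longrightarrow> A (w i) = \<theta> i *s w i" and inj: "inj_on \<theta> {..n}"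
  shows "(\<Sum>i\<le>n. a i *s w i) = 0 \<Longrightarrow> \<forall>i\<le>n. a i = 0"
  using w eig inj
proof (induction n arbitrary: a)
  case 0
  then show ?case by simp
next
  case (Suc n)
  have "A (\<Sum>i\<le>Suc n. a i *s w i) = (\<Sum>i\<le>Suc n. a i *s A (w i))"
    using Suc.prems(2) by (intro linear_map_sum[OF A vector_space_axioms]) auto
  also have "\<dots> = (\<Sum>i\<le>Suc n. (a i * \<theta> i) *s w i)"
    using Suc.prems(4) by (intro sum.cong) auto
  finally have "(\<Sum>i\<le>Suc n. (a i * \<theta> i) *s w i) = A 0" using Suc.prems(1) by simp
  also have "A 0 = 0"
    using linear_map_sum[OF A vector_space_axioms, of "{} :: nat set" w a] by simp
  finally have "(\<Sum>i\<le>Suc n. (a i * \<theta> i) *s w i) - \<theta> (Suc n) *s (\<Sum>i\<le>Suc n. a i *s w i) = 0"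
    using Suc.prems(1) by simp
  then have "(\<Sum>i\<le>n. (a i * (\<theta> i - \<theta> (Suc n))) *s w i) = 0"
    by (simp add: scale_sum_right scale_right_distrib algebra_simps sum_subtractf)
  then have "\<forall>i\<le>n. a i * (\<theta> i - \<theta> (Suc n)) = 0"
    using Suc.prems(2-5) by (intro Suc.IH) (auto simp: inj_on_def)
  then have *: "\<forall>i\<le>n. a i = 0"
    using Suc.prems(5) by (force simp: inj_on_def)
  then have "a (Suc n) *s w (Suc n) = 0" using Suc.prems(1) by simp
  then have "a (Suc n) = 0" using Suc.prems(3) by auto
  with * show ?case by (auto simp: le_Suc_eq)
qed

section \<open>Matrices of linear maps\<close>

lemma eigenvalues_iff_represents:
  "eigenvalues scale n v A \<theta> \<longleftrightarrow> represents scale n v A (\<lambda>i j. if i = j then \<theta> i else 0)"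
  by (simp add: eigenvalues_def represents_def if_distrib[of "\<lambda>c. c *s _"] sum.delta cong: if_cong)

lemma represents_unique:
  assumes "is_basis scale V n v" "represents scale n v A B" "represents scale n v A C" "i \<le> n" "j \<le> n"
  shows "B i j = C i j"
  using is_basis_unique[OF assms(1), of "\<lambda>i. B i j" "\<lambda>i. C i j" i] assms(2-5)
  unfolding represents_def by metis

lemma represents_apply:
  assumes "is_basis scale V n v" "linear_map scale scale V V A" "represents scale n v A B"
  shows "A (\<Sum>j\<le>n. a j *s v j) = (\<Sum>i\<le>n. (\<Sum>j\<le>n. B i j * a j) *s v i)"
proof -
  have "A (\<Sum>j\<le>n. a j *s v j) = (\<Sum>j\<le>n. a j *s A (v j))"
    using is_basis_mem[OF assms(1)]
    by (intro linear_map_sum[OF assms(2) is_basis_subspace[OF assms(1)] vector_space_axioms]) auto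
  also have "\<dots> = (\<Sum>j\<le>n. \<Sum>i\<le>n. (B i j * a j) *s v i)"
    using assms(3) by (intro sum.cong refl) (simp add: represents_def scale_sum_right mult.commute)
  also have "\<dots> = (\<Sum>i\<le>n. \<Sum>j\<le>n. (B i j * a j) *s v i)"
    by (rule sum.swap)
  finally show ?thesis by (simp add: scale_sum_left)
qed

lemma represents_compose:
  assumes "is_basis scale V n v" "linear_map scale scale V V A" "represents scale n v A B"
    and "represents scale n v A' B'"
  shows "represents scale n v (\<lambda>x. A (A' x)) (\<lambda>i j. \<Sum>l\<le>n. B i l * B' l j)"
  using assms(4) represents_apply[OF assms(1-3)] unfolding represents_def by simp

lemma represents_add:
  assumes "represents scale n v A B" "represents scale n v A' B'"
  shows "represents scale n v (\<lambda>x. A x + A' x) (\<lambda>i j. B i j + B' i j)"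
  using assms unfolding represents_def by (simp add: scale_left_distrib sum.distrib)

lemma represents_scale:
  assumes "represents scale n v A B"
  shows "represents scale n v (\<lambda>x. c *s A x) (\<lambda>i j. c * B i j)"
  using assms unfolding represents_def by (simp add: scale_sum_right)

text \<open>The three-term recurrence determines an eigenvector from its first coordinate.\<close>

lemma eigenvector_vanishing_first_coordinate:
  assumes "is_basis scale V n v" "linear_map scale scale V V A" "represents scale n v A B"
    and "irreducible_tridiagonal n B"
    and eig: "A (\<Sum>i\<le>n. a i *s v i) = c *s (\<Sum>i\<le>n. a i *s v i)" and "a 0 = 0"
  shows "i \<le> n \<Longrightarrow> a i = 0"
proof (induction i rule: less_induct)
  case (less m)
  show ?case
  proof (cases m)
    case 0
    then show ?thesis using assms by simp
  next
    case (Suc i)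
    have "(\<Sum>i\<le>n. (\<Sum>j\<le>n. B i j * a j) *s v i) = (\<Sum>i\<le>n. (c * a i) *s v i)"
      using eig unfolding represents_apply[OF assms(1-3)] by (simp add: scale_sum_right)
    then have "(\<Sum>j\<le>n. B i j * a j) = c * a i"
      using less.prems Suc
      by (intro is_basis_unique[OF assms(1), of "\<lambda>i. \<Sum>j\<le>n. B i j * a j" "\<lambda>i. c * a i"]) auto
    also have "c * a i = 0" using less Suc by simp
    \<comment> \<open>Row \<open>i = m - 1\<close> reaches no column beyond \<open>m\<close>, and
      the earlier coordinates vanish by induction; only the term at \<open>m\<close> is left, with a
      nonzero superdiagonal entry.\<close>
    also have "(\<Sum>j\<le>n. B i j * a j) = (\<Sum>j\<in>{m}. B i j * a j)"
    proof (rule sum.mono_neutral_right)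
      show "\<forall>j\<in>{..n} - {m}. B i j * a j = 0"
      proof
        fix j assume j: "j \<in> {..n} - {m}"
        show "B i j * a j = 0"
        proof (cases "j < m")
          case True
          then show ?thesis using less by simp
        next
          case False
          then have "i \<noteq> j" "i \<noteq> Suc j" "j \<noteq> Suc i" "i \<le> n" "j \<le> n"
            using j Suc less.prems by auto
          then have "B i j = 0"
            using assms(4) unfolding irreducible_tridiagonal_def tridiagonal_def by blast
          then show ?thesis by simp
        qed
      qed
    qed (use less.prems in auto)
    finally show ?thesis
      using assms(4) Suc less.prems unfolding irreducible_tridiagonal_def by auto
  qed
qed

text \<open>Two eigenvectors with the same eigenvalue have a combination whose first coordinate in
  \<open>w\<close> vanishes, so it is zero. Independence of \<open>v\<close> then makes the first
  coordinate of \<open>v i\<close> vanish, and with it \<open>v i\<close>.\<close>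

lemma irreducible_tridiagonal_eigenvalues_inj:
  assumes w: "is_basis scale V n w" "represents scale n w A B" "irreducible_tridiagonal n B"
    and A: "linear_map scale scale V V A"
    and v: "is_basis scale V n v" "eigenvalues scale n v A \<theta>"
  shows "inj_on \<theta> {..n}"
proof (rule inj_onI, rule ccontr)
  fix i j assume ij: "i \<in> {..n}" "j \<in> {..n}" "\<theta> i = \<theta> j" "i \<noteq> j"
  obtain a where a: "v i = (\<Sum>l\<le>n. a l *s w l)"
    using is_basis_expand[OF w(1) is_basis_mem[OF v(1)]] ij by auto
  obtain b where b: "v j = (\<Sum>l\<le>n. b l *s w l)"
    using is_basis_expand[OF w(1) is_basis_mem[OF v(1)]] ij by auto
  have eq: "(\<Sum>l\<le>n. (b 0 * a l - a 0 * b l) *s w l) = b 0 *s v i - a 0 *s v j"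
    unfolding a b by (simp add: scale_left_diff_distrib sum_subtractf scale_sum_right)
  have comb: "(\<Sum>l\<le>n. (if l = i then p else if l = j then q else 0) *s v l) = p *s v i + q *s v j" for p q
  proof -
    have "(\<Sum>l\<le>n. (if l = i then p else if l = j then q else 0) *s v l) =
      (\<Sum>l\<le>n. (if l = i then p *s v l else 0) + (if l = j then q *s v l else 0))"
      using ij by (intro sum.cong) auto
    then show ?thesis using ij by (simp add: sum.distrib sum.delta)
  qed
  have "A (b 0 *s v i + (- a 0) *s v j) = b 0 *s A (v i) + (- a 0) *s A (v j)"
    using A ij is_basis_mem[OF v(1)] subspace_scale[OF is_basis_subspace[OF v(1)]]
    unfolding linear_map_def by (metis atMost_iff)
  then have "A (b 0 *s v i + (- a 0) *s v j) = \<theta> i *s (b 0 *s v i + (- a 0) *s v j)"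
    using v(2) ij unfolding eigenvalues_def by (simp add: algebra_simps)
  then have "A (\<Sum>l\<le>n. (b 0 * a l - a 0 * b l) *s w l) =
      \<theta> i *s (\<Sum>l\<le>n. (b 0 * a l - a 0 * b l) *s w l)"
    unfolding eq by simp
  then have "\<And>l. l \<le> n \<Longrightarrow> b 0 * a l - a 0 * b l = 0"
    by (rule eigenvector_vanishing_first_coordinate[OF w(1) A w(2,3)]) simp_all
  then have "b 0 *s v i + (- a 0) *s v j = 0"
    using eq by simp
  then have "\<forall>l\<le>n. (if l = i then b 0 else if l = j then - a 0 else 0) = 0"
    using v(1)[unfolded is_basis_iff] comb[of "b 0" "- a 0"]
    by (auto dest!: spec[of _ "\<lambda>l. if l = i then b 0 else if l = j then - a 0 else 0"])
  then have "a 0 = 0" using ij by (metis atMost_iff neg_equal_0_iff_equal)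
  moreover have "A (\<Sum>l\<le>n. a l *s w l) = \<theta> i *s (\<Sum>l\<le>n. a l *s w l)"
    using v(2) ij unfolding a[symmetric] eigenvalues_def by simp
  ultimately have "\<And>l. l \<le> n \<Longrightarrow> a l = 0"
    using eigenvector_vanishing_first_coordinate[OF w(1) A w(2,3)] by blast
  then have "v i = 0" unfolding a by simp
  then show False using is_basis_nonzero[OF v(1)] ij by simp
qed

lemma standard_basis_eigenvalues:
  assumes "standard_basis scale V A S v"
  obtains \<theta> where "eigenvalues scale (diameter scale V) v A \<theta>"
proof -
  obtain D where D: "represents scale (diameter scale V) v A D" "diagonal (diameter scale V) D"
    using assms unfolding standard_basis_def by blast
  have "eigenvalues scale (diameter scale V) v A (\<lambda>i. D i i)"
    unfolding eigenvalues_def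
  proof (intro allI impI)
    fix j assume j: "j \<le> diameter scale V"
    have "A (v j) = (\<Sum>i\<le>diameter scale V. D i j *s v i)"
      using D(1) j by (simp add: represents_def)
    also have "\<dots> = (\<Sum>i\<in>{j}. D i j *s v i)"
      using D(2) j by (intro sum.mono_neutral_right) (auto simp: diagonal_def)
    finally show "A (v j) = D j j *s v j" by simp
  qed
  then show ?thesis by (rule that)
qed

lemma standard_basis_eigenvalues_inj:
  assumes "standard_basis scale V A S v" "eigenvalues scale (diameter scale V) v A \<theta>"
    and "standard_basis scale V X T w" "A \<in> T" "linear_map scale scale V V A"
  shows "inj_on \<theta> {..diameter scale V}"
  using assms irreducible_tridiagonal_eigenvalues_inj[of V "diameter scale V" w A _ v \<theta>]
  unfolding standard_basis_def by blast

end

section \<open>Maps satisfying the anticommutator relations\<close>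

text \<open>Only linearity and the relations are assumed, so the same results serve to analyse a
  given Leonard triple and to verify that constructed maps form one.\<close>

locale anticommuting_maps = vector_space scale
  for scale :: "'k::field_char_0 \<Rightarrow> 'v::ab_group_add \<Rightarrow> 'v" (infixr \<open>*s\<close> 75) +
  fixes V :: "'v set" and A As Ae :: "'v \<Rightarrow> 'v" and \<zeta> \<zeta>s \<zeta>e :: 'k
  assumes subspace: "subspace V"
    and linear_A: "linear_map scale scale V V A"
    and linear_As: "linear_map scale scale V V As"
    and linear_Ae: "linear_map scale scale V V Ae"
    and relations: "anticommutator_relations scale V \<zeta> \<zeta>s \<zeta>e A As Ae"
begin

text \<open>Each scalar moves with its map: \<open>\<zeta>\<close> with \<open>A\<close>,
  \<open>\<zeta>s\<close> with \<open>As\<close>, \<open>\<zeta>e\<close> with \<open>Ae\<close>.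
  Together with \<open>swap\<close> this reaches all six orders of the maps.\<close>

lemma rotate: "anticommuting_maps scale V As Ae A \<zeta>s \<zeta>e \<zeta>"
  using subspace linear_A linear_As linear_Ae relations
  by unfold_locales (auto simp: anticommutator_relations_def)

lemma swap: "anticommuting_maps scale V A Ae As \<zeta> \<zeta>e \<zeta>s"
  using subspace linear_A linear_As linear_Ae relations
  by unfold_locales (auto simp: anticommutator_relations_def add.commute)

text \<open>Multiplication by the diagonal matrix of \<open>A\<close> on the left or right scales
  entry \<open>(i, j)\<close> by \<open>\<theta> i\<close> or \<open>\<theta> j\<close>. Hence
  \<open>A\<close> and \<open>As\<close> determine \<open>Ae\<close>, on which uniqueness
  relies.\<close>

lemma represents_Ae:
  assumes v: "is_basis scale V n v" "eigenvalues scale n v A \<theta>" "represents scale n v As B"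
  shows "represents scale n v Ae (\<lambda>i j. \<zeta>e * (\<theta> i + \<theta> j) * B i j)"
proof -
  note A = v(2)[unfolded eigenvalues_iff_represents]
  note r = represents_scale[OF represents_add[OF represents_compose[OF v(1) linear_A A v(3)]
    represents_compose[OF v(1) linear_As v(3) A]], of \<zeta>e]
  show ?thesis
    unfolding represents_def
  proof (intro allI impI)
    fix j assume j: "j \<le> n"
    have "Ae (v j) = \<zeta>e *s (A (As (v j)) + As (A (v j)))"
      using relations is_basis_mem[OF v(1) j] by (simp add: anticommutator_relations_def)
    also have "\<dots> = (\<Sum>i\<le>n. (\<zeta>e * (\<theta> i + \<theta> j) * B i j) *s v i)"
      using r j unfolding represents_def
      by (auto simp: if_distrib[of "\<lambda>c. c * _"] if_distrib[of "(*) _"] sum.delta algebra_simps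
          intro!: sum.cong cong: if_cong)
    finally show "Ae (v j) = (\<Sum>i\<le>n. (\<zeta>e * (\<theta> i + \<theta> j) * B i j) *s v i)" .
  qed
qed

text \<open>Going from \<open>As\<close> to \<open>Ae\<close> by the first relation and back by the
  third, through \<open>swap\<close>, multiplies the entry by both factors.\<close>

lemma entry_relation:
  assumes v: "is_basis scale V n v" "eigenvalues scale n v A \<theta>" "represents scale n v As B"
    and "i \<le> n" "j \<le> n"
  shows "B i j = \<zeta>s * \<zeta>e * (\<theta> i + \<theta> j)\<^sup>2 * B i j"
proof -
  interpret sw: anticommuting_maps scale V A Ae As \<zeta> \<zeta>e \<zeta>s by (rule swap)
  have "B i j = \<zeta>s * (\<theta> i + \<theta> j) * (\<zeta>e * (\<theta> i + \<theta> j) * B i j)"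
    using represents_unique[OF v(1,3) sw.represents_Ae[OF v(1,2) represents_Ae[OF v]]] assms(4,5) .
  then show ?thesis by (simp add: power2_eq_square mult_ac)
qed

lemma diagonal_relation:
  assumes v: "is_basis scale V n v" "eigenvalues scale n v A \<theta>" "represents scale n v As B"
    and j: "j \<le> n"
  shows "\<theta> j = 2 * \<zeta> * \<zeta>e * (\<Sum>l\<le>n. (\<theta> l + \<theta> j) * B j l * B l j)"
proof -
  define Be where "Be i j = \<zeta>e * (\<theta> i + \<theta> j) * B i j" for i j
  have Be: "represents scale n v Ae Be"
    using represents_Ae[OF v] unfolding Be_def .
  have "represents scale n v A (\<lambda>i j. \<zeta> * ((\<Sum>l\<le>n. B i l * Be l j) + (\<Sum>l\<le>n. Be i l * B l j)))"
    using represents_scale[OF represents_add[OF represents_compose[OF v(1) linear_As v(3) Be]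
        represents_compose[OF v(1) linear_Ae Be v(3)]], of \<zeta>] relations is_basis_mem[OF v(1)]
    unfolding represents_def anticommutator_relations_def by simp
  from represents_unique[OF v(1) v(2)[unfolded eigenvalues_iff_represents] this j j]
  show ?thesis
    by (simp add: Be_def sum_distrib_left sum.distrib[symmetric] algebra_simps)
qed

lemma consecutive_eigenvalues:
  assumes "is_basis scale V n v" "eigenvalues scale n v A \<theta>" "represents scale n v As B"
    and "irreducible_tridiagonal n B" "i < n"
  shows "\<zeta>s * \<zeta>e * (\<theta> i + \<theta> (Suc i))\<^sup>2 = 1"
  using entry_relation[OF assms(1-3), of i "Suc i"] assms(4,5)
  unfolding irreducible_tridiagonal_def by auto

text \<open>Neighbouring sums have equal squares, and equal neighbouring sums would give
  \<open>\<theta> i = \<theta> (i + 2)\<close>; so each sum is the negative of the previous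
  one.\<close>

lemma alternating_eigenvalue_sums:
  assumes v: "is_basis scale V n v" "eigenvalues scale n v A \<theta>" "represents scale n v As B"
    "irreducible_tridiagonal n B"
    and inj: "inj_on \<theta> {..n}"
  shows "i < n \<Longrightarrow> \<theta> i + \<theta> (Suc i) = (-1) ^ i * (\<theta> 0 + \<theta> 1)"
proof (induction i)
  case (Suc i)
  define p q where "p = \<theta> i + \<theta> (Suc i)" and "q = \<theta> (Suc i) + \<theta> (Suc (Suc i))"
  have p: "\<zeta>s * \<zeta>e * p\<^sup>2 = 1" and q: "\<zeta>s * \<zeta>e * q\<^sup>2 = 1"
    unfolding p_def q_def using consecutive_eigenvalues[OF v] Suc.prems by simp_all
  then have "\<zeta>s * \<zeta>e \<noteq> 0" by auto
  then have "p\<^sup>2 = q\<^sup>2" using p q by (metis mult_left_cancel)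
  moreover have "p \<noteq> q"
    using inj_onD[OF inj, of i "Suc (Suc i)"] Suc.prems unfolding p_def q_def by auto
  ultimately have "q = - p" by (auto simp: power2_eq_iff)
  then show ?case using Suc unfolding p_def q_def by simp
qed simp

lemma eigenvalue_formula:
  assumes v: "is_basis scale V n v" "eigenvalues scale n v A \<theta>" "represents scale n v As B"
    "irreducible_tridiagonal n B"
    and inj: "inj_on \<theta> {..n}"
  shows "i \<le> n \<Longrightarrow> \<theta> i = (-1) ^ i * (\<theta> 0 - of_nat i * (\<theta> 0 + \<theta> 1))"
proof (induction i)
  case (Suc i)
  have "\<theta> (Suc i) = (-1) ^ i * (\<theta> 0 + \<theta> 1) - \<theta> i"
    using alternating_eigenvalue_sums[OF assms, of i] Suc.prems by (simp add: eq_diff_eq add.commute)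
  also have "\<theta> i = (-1) ^ i * (\<theta> 0 - of_nat i * (\<theta> 0 + \<theta> 1))"
    using Suc by simp
  finally show ?case by (simp add: algebra_simps)
qed simp

text \<open>Sums two places apart agree, and \<open>\<theta> j + \<theta> (j + 1) = \<theta> (j + 2)
  + \<theta> (j + 3)\<close> is the ratio condition rearranged.\<close>

lemma bannai_ito_ratio:
  assumes v: "standard_basis scale V A S v" "As \<in> S" "eigenvalues scale (diameter scale V) v A \<theta>"
    and w: "standard_basis scale V X T w" "A \<in> T"
    and i: "i \<in> {2..diameter scale V - 1}"
  shows "(\<theta> (i - 2) - \<theta> (i + 1)) / (\<theta> (i - 1) - \<theta> i) = - 1"
proof -
  let ?n = "diameter scale V"
  obtain B where B: "is_basis scale V ?n v" "represents scale ?n v As B" "irreducible_tridiagonal ?n B"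
    using v(1,2) unfolding standard_basis_def by blast
  have inj: "inj_on \<theta> {..?n}"
    by (rule standard_basis_eigenvalues_inj[OF v(1,3) w linear_A])
  note alt = alternating_eigenvalue_sums[OF B(1) v(3) B(2,3) inj]
  obtain j where j: "i = j + 2" "j + 3 \<le> ?n"
    using i by (auto simp: le_iff_add[of 2])
  have "\<theta> j + \<theta> (Suc j) = \<theta> (j + 2) + \<theta> (j + 3)"
    using alt[of j] alt[of "j + 2"] j by (simp add: eval_nat_numeral)
  moreover have "\<theta> (Suc j) \<noteq> \<theta> (j + 2)"
    using inj_onD[OF inj, of "Suc j" "j + 2"] j by auto
  ultimately show ?thesis
    using j by (simp add: field_simps eval_nat_numeral)
qed

lemma leonard_pair_bannai_ito:
  assumes "fin_dim_space scale V" "3 \<le> diameter scale V"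
    and v: "standard_basis scale V A S v" "As \<in> S"
    and w: "standard_basis scale V As T w" "A \<in> T"
  shows "leonard_pair_bannai_ito scale V A As"
proof -
  interpret sw: anticommuting_maps scale V As A Ae \<zeta>s \<zeta> \<zeta>e
    by (rule anticommuting_maps.swap[OF rotate])
  have "standard_basis scale V A {As} v" "standard_basis scale V As {A} w"
    using v w unfolding standard_basis_def by auto
  then show ?thesis
    using assms(1,2) linear_A linear_As bannai_ito_ratio sw.bannai_ito_ratio
    unfolding leonard_pair_bannai_ito_def leonard_pair_def by blast
qed

text \<open>Here \<open>u\<close> is one known eigenbasis and \<open>v\<close> an arbitrary one:
  bipartiteness is demanded in every standard basis, so the eigenvalues at \<open>v\<close> are
  first located among those at \<open>u\<close>.\<close>

lemma zero_diagonal: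
  assumes u: "is_basis scale V d u" "eigenvalues scale d u A (\<lambda>i. (-1) ^ i * (of_nat d / 2 - of_nat i) * \<mu>)"
    and \<mu>: "\<zeta>s * \<zeta>e * \<mu>\<^sup>2 = 1" and d: "even d"
    and v: "is_basis scale V n v" "eigenvalues scale n v A \<theta>" "represents scale n v As B"
    and i: "i \<le> n"
  shows "B i i = 0"
proof (rule ccontr)
  assume B: "B i i \<noteq> 0"
  \<comment> \<open>Then \<open>4 \<zeta>s \<zeta>e (\<theta> i)\<^sup>2 = 1\<close>, so the even integer \<open>d - 2 l\<close> would have square \<open>1\<close>.\<close>
  let ?\<phi> = "\<lambda>i. (-1) ^ i * (of_nat d / 2 - of_nat i) * \<mu>"
  obtain a where a: "v i = (\<Sum>l\<le>d. a l *s u l)"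
    using is_basis_expand[OF u(1) is_basis_mem[OF v(1) i]] .
  have "A (v i) = (\<Sum>l\<le>d. a l *s A (u l))"
    unfolding a using is_basis_mem[OF u(1)]
    by (intro linear_map_sum[OF linear_A subspace vector_space_axioms]) auto
  also have "\<dots> = (\<Sum>l\<le>d. (a l * ?\<phi> l) *s u l)"
    using u(2) unfolding eigenvalues_def by (intro sum.cong) auto
  finally have "(\<Sum>l\<le>d. (a l * ?\<phi> l) *s u l) = \<theta> i *s v i"
    using v(2) i by (simp add: eigenvalues_def)
  also have "\<dots> = (\<Sum>l\<le>d. (\<theta> i * a l) *s u l)"
    unfolding a by (simp add: scale_sum_right)
  finally have eq: "\<And>l. l \<le> d \<Longrightarrow> a l * ?\<phi> l = \<theta> i * a l"
    using is_basis_unique[OF u(1), of "\<lambda>l. a l * ?\<phi> l" "\<lambda>l. \<theta> i * a l"] by blast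
  have "\<exists>l\<le>d. a l \<noteq> 0"
  proof (rule ccontr)
    assume "\<not> ?thesis"
    then have "v i = 0" unfolding a by simp
    then show False using is_basis_nonzero[OF v(1) i] by simp
  qed
  then obtain l where l: "l \<le> d" "\<theta> i = ?\<phi> l"
    using eq by (metis mult.commute mult_right_cancel)
  have "\<zeta>s * \<zeta>e * (\<theta> i + \<theta> i)\<^sup>2 = 1"
    using entry_relation[OF v i i] B by simp
  also have "\<zeta>s * \<zeta>e * (\<theta> i + \<theta> i)\<^sup>2 = (of_nat d - 2 * of_nat l)\<^sup>2 * (\<zeta>s * \<zeta>e * \<mu>\<^sup>2)"
    unfolding l(2) by (simp add: power2_eq_square algebra_simps power_mult_distrib[symmetric])
  finally have "of_int ((int d - 2 * int l)\<^sup>2) = (of_int 1 :: 'k)"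
    using \<mu> by simp
  then have "(int d - 2 * int l)\<^sup>2 = 1"
    by (simp only: of_int_eq_iff)
  then have "odd ((int d - 2 * int l)\<^sup>2)" by simp
  then show False using d by simp
qed

text \<open>With zero diagonal, \<open>diagonal_relation\<close> at \<open>j\<close> involves only
  the products of opposite entries on either side of \<open>j\<close>, and the alternating sums give
  them opposite signs. The recurrence has one more equation than unknown products, which fixes
  \<open>\<theta> 0\<close>.\<close>

lemma bipartite_parameters:
  assumes v: "is_basis scale V n v" "eigenvalues scale n v A \<theta>" "represents scale n v As B"
    "irreducible_tridiagonal n B"
    and inj: "inj_on \<theta> {..n}"
    and n: "1 \<le> n" and diag: "\<And>i. i \<le> n \<Longrightarrow> B i i = 0"
  defines "c \<equiv> \<theta> 0 + \<theta> 1"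
  shows "\<zeta>s * \<zeta>e * c\<^sup>2 = 1" "\<zeta> \<noteq> 0" "even n"
    "\<And>i. i \<le> n \<Longrightarrow> \<theta> i = (-1) ^ i * (of_nat n / 2 - of_nat i) * c"
    "\<And>i. i < n \<Longrightarrow> B i (Suc i) * B (Suc i) i = of_nat (Suc i) * of_nat (n - i) / (4 * \<zeta> * \<zeta>e)"
proof -
  show c: "\<zeta>s * \<zeta>e * c\<^sup>2 = 1"
    using consecutive_eigenvalues[OF v, of 0] n by (simp add: c_def)
  then have c0: "c \<noteq> 0" "\<zeta>e \<noteq> 0" by auto
  note alt = alternating_eigenvalue_sums[OF v inj, folded c_def]
  note form = eigenvalue_formula[OF v inj, folded c_def]
  \<comment> \<open>With \<open>\<zeta> = 0\<close> the diagonal relation would make both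
    \<open>\<theta> 0\<close> and \<open>\<theta> 1\<close> zero.\<close>
  have "\<theta> 0 \<noteq> \<theta> 1" using inj n by (auto simp: inj_on_def)
  then show \<zeta>: "\<zeta> \<noteq> 0"
    using diagonal_relation[OF v(1-3), of 0] diagonal_relation[OF v(1-3), of 1] n by auto
  \<comment> \<open>\<open>P\<close> is shifted by one so that both boundary values \<open>P 0\<close> and \<open>P (Suc n)\<close> vanish.\<close>
  define P where "P m = (if m = 0 \<or> n < m then 0 else B (m - 1) m * B m (m - 1))" for m
  have sum: "(\<Sum>l\<le>n. (\<theta> l + \<theta> j) * B j l * B l j) = (-1) ^ j * c * (P (Suc j) - P j)"
    if j: "j \<le> n" for j
  proof -
    let ?f = "\<lambda>l. (\<theta> l + \<theta> j) * B j l * B l j"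
    have "(\<Sum>l\<le>n. ?f l) = (\<Sum>l\<le>n. (if l = Suc j then ?f (Suc j) else 0) + (if Suc l = j then ?f l else 0))"
    proof (intro sum.cong refl)
      fix l assume l: "l \<in> {..n}"
      consider "l = Suc j" | "Suc l = j" | "l = j" | "l \<noteq> j" "l \<noteq> Suc j" "j \<noteq> Suc l" by auto
      then show "?f l = (if l = Suc j then ?f (Suc j) else 0) + (if Suc l = j then ?f l else 0)"
      proof cases
        case 4
        then have "B j l = 0"
          using v(4) l j unfolding irreducible_tridiagonal_def tridiagonal_def by (metis atMost_iff)
        with 4 show ?thesis by simp
      qed (use diag[OF j] in auto)
    qed
    also have "\<dots> = (\<Sum>l\<le>n. if l = Suc j then ?f (Suc j) else 0) + (\<Sum>l\<le>n. if Suc l = j then ?f l else 0)"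
      by (rule sum.distrib)
    also have "(\<Sum>l\<le>n. if l = Suc j then ?f (Suc j) else 0) = (-1) ^ j * c * P (Suc j)"
      using alt[of j] by (auto simp: sum.delta P_def add.commute)
    also have "(\<Sum>l\<le>n. if Suc l = j then ?f l else 0) = - ((-1) ^ j * c * P j)"
    proof (cases j)
      case (Suc m)
      have "(\<Sum>l\<le>n. if Suc l = j then ?f l else 0) = ?f m"
        using Suc j by (simp add: sum.delta)
      then show ?thesis using alt[of m] Suc j by (simp add: P_def mult_ac)
    qed (simp add: P_def)
    finally show ?thesis by (simp add: algebra_simps)
  qed
  have step: "2 * \<zeta> * \<zeta>e * c * (P (Suc j) - P j) = \<theta> 0 - of_nat j * c" if j: "j \<le> n" for j
  proof -
    have "(-1) ^ j * (\<theta> 0 - of_nat j * c) = 2 * \<zeta> * \<zeta>e * ((-1) ^ j * c * (P (Suc j) - P j))"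
      using diagonal_relation[OF v(1-3) j] sum[OF j] form[OF j] by simp
    also have "\<dots> = (-1) ^ j * (2 * \<zeta> * \<zeta>e * c * (P (Suc j) - P j))"
      by (simp add: mult_ac)
    finally show ?thesis by simp
  qed
  \<comment> \<open>Sum of the steps from \<open>0\<close> to \<open>m - 1\<close>, doubled to clear
    the denominator of the triangular number.\<close>
  have P: "4 * \<zeta> * \<zeta>e * c * P m = of_nat m * (2 * \<theta> 0 - (of_nat m - 1) * c)" if "m \<le> Suc n" for m
    using that
  proof (induction m)
    case (Suc m)
    have "4 * \<zeta> * \<zeta>e * c * P (Suc m) = 2 * (2 * \<zeta> * \<zeta>e * c * (P (Suc m) - P m)) + 4 * \<zeta> * \<zeta>e * c * P m"
      by (simp add: algebra_simps)
    also have "\<dots> = 2 * (\<theta> 0 - of_nat m * c) + of_nat m * (2 * \<theta> 0 - (of_nat m - 1) * c)"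
      using Suc step[of m] by simp
    finally show ?case by (simp add: algebra_simps)
  qed (simp add: P_def)
  have "of_nat (Suc n) * (2 * \<theta> 0 - of_nat n * c) = 0"
    using P[of "Suc n"] by (simp add: P_def)
  then have "2 * \<theta> 0 - of_nat n * c = 0"
    by (metis mult_eq_0_iff of_nat_eq_0_iff nat.distinct(1))
  then have \<theta>0: "\<theta> 0 = of_nat n / 2 * c" by (simp add: field_simps)
  show \<theta>: "\<theta> i = (-1) ^ i * (of_nat n / 2 - of_nat i) * c" if "i \<le> n" for i
    using form[OF that] by (simp add: \<theta>0 algebra_simps)
  show "even n"
  proof (rule ccontr)
    assume "odd n"
    then have "\<theta> n * 2 = \<theta> 0 * 2" using \<theta>[of n] \<theta>0 by (simp add: field_simps)
    then have "\<theta> n = \<theta> 0" by simp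
    then show False using inj n by (auto simp: inj_on_def)
  qed
  show "B i (Suc i) * B (Suc i) i = of_nat (Suc i) * of_nat (n - i) / (4 * \<zeta> * \<zeta>e)" if "i < n" for i
  proof -
    have "4 * \<zeta> * \<zeta>e * c * P (Suc i) = of_nat (Suc i) * (of_nat n * c - of_nat i * c)"
      using P[of "Suc i"] that \<theta>0 by simp
    also have "\<dots> = of_nat (Suc i) * of_nat (n - i) * c"
      using that by (simp add: of_nat_diff algebra_simps)
    finally have "4 * \<zeta> * \<zeta>e * P (Suc i) = of_nat (Suc i) * of_nat (n - i)"
      using c0 by (simp add: mult_ac)
    then show ?thesis using that c0 \<zeta> by (simp add: P_def field_simps)
  qed
qed

end

section \<open>Ladder operators\<close>

text \<open>Both sequences are indexed by column: \<open>p j\<close> is the coefficient that raises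
  the \<open>j\<close>-th basis vector, \<open>q j\<close> the one that lowers it.\<close>

definition tridiag :: "(nat \<Rightarrow> 'k::zero) \<Rightarrow> (nat \<Rightarrow> 'k) \<Rightarrow> nat \<Rightarrow> nat \<Rightarrow> 'k" where
  "tridiag p q i j = (if i = Suc j then p j else if j = Suc i then q j else 0)"

lemma irreducible_tridiagonal_tridiag:
  assumes "\<And>j. j < n \<Longrightarrow> p j \<noteq> 0" "\<And>j. j < n \<Longrightarrow> q (Suc j) \<noteq> 0"
  shows "irreducible_tridiagonal n (tridiag p q)"
  using assms by (auto simp: irreducible_tridiagonal_def tridiagonal_def tridiag_def)

text \<open>Doubling gives an equation of integers. Indices of equal parity must agree; indices of
  opposite parity would satisfy \<open>i + j = d\<close>, impossible for even
  \<open>d\<close>.\<close>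

lemma inj_alternating:
  assumes "even d" "\<mu> \<noteq> (0 :: 'k::field_char_0)"
  shows "inj (\<lambda>i. (-1) ^ i * (of_nat d / 2 - of_nat i) * \<mu>)"
proof (rule injI)
  fix i j :: nat
  assume "(-1) ^ i * (of_nat d / 2 - of_nat i) * \<mu> = (-1) ^ j * (of_nat d / 2 - of_nat j) * \<mu>"
  then have "2 * ((-1) ^ i * (of_nat d / 2 - of_nat i)) =
      2 * ((-1) ^ j * (of_nat d / 2 - of_nat j) :: 'k)"
    using assms(2) by simp
  then have "(of_int ((-1) ^ i * (int d - 2 * int i)) :: 'k) = of_int ((-1) ^ j * (int d - 2 * int j))"
    by (simp add: algebra_simps)
  then have *: "(-1) ^ i * (int d - 2 * int i) = (-1) ^ j * (int d - 2 * int j)"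
    by (simp only: of_int_eq_iff)
  show "i = j"
  proof (cases "even i = even j")
    case True
    then have "(-1) ^ i = ((-1) ^ j :: int)" by (simp add: minus_one_power_iff)
    then show ?thesis using * by simp
  next
    case False
    then have "int i + int j = int d"
      using * by (simp add: minus_one_power_iff split: if_splits)
    then have "i + j = d" by simp
    then show ?thesis using False assms(1) by auto
  qed
qed

context vector_space
begin

lemma represents_tridiag:
  assumes "\<And>j. j \<le> n \<Longrightarrow>
    A (v j) = (if j < n then p j *s v (Suc j) else 0) + (if 0 < j then q j *s v (j - 1) else 0)"
  shows "represents scale n v A (tridiag p q)"
  unfolding represents_def
proof (intro allI impI)
  fix j assume j: "j \<le> n"
  have "(\<Sum>i\<le>n. tridiag p q i j *s v i) =
    (\<Sum>i\<le>n. (if i = Suc j then p j *s v i else 0) + (if j = Suc i then q j *s v i else 0))"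
    by (intro sum.cong) (auto simp: tridiag_def)
  also have "\<dots> = (\<Sum>i\<le>n. if i = Suc j then p j *s v i else 0) + (\<Sum>i\<le>n. if j = Suc i then q j *s v i else 0)"
    by (rule sum.distrib)
  also have "(\<Sum>i\<le>n. if i = Suc j then p j *s v i else 0) = (if j < n then p j *s v (Suc j) else 0)"
    by (auto simp: sum.delta)
  also have "(\<Sum>i\<le>n. if j = Suc i then q j *s v i else 0) = (if 0 < j then q j *s v (j - 1) else 0)"
    using j by (cases j) (auto simp: sum.delta)
  finally show "A (v j) = (\<Sum>i\<le>n. tridiag p q i j *s v i)"
    using assms[OF j] by simp
qed

end

section \<open>Raising and lowering eigenvectors of \<open>As\<close>\<close>

context anticommuting_maps
begin

lemma maps_closed:
  assumes "x \<in> V"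
  shows "A x \<in> V" "As x \<in> V" "Ae x \<in> V" "c *s x \<in> V"
  using assms linear_A linear_As linear_Ae subspace_scale[OF subspace]
  by (auto simp: linear_map_def)

lemma maps_linear:
  assumes "x \<in> V"
  shows "A (c *s x) = c *s A x" "As (c *s x) = c *s As x" "Ae (c *s x) = c *s Ae x"
    and "y \<in> V \<Longrightarrow> A (x + y) = A x + A y" "y \<in> V \<Longrightarrow> As (x + y) = As x + As y"
    "y \<in> V \<Longrightarrow> Ae (x + y) = Ae x + Ae y"
    and "y \<in> V \<Longrightarrow> A (x - y) = A x - A y" "y \<in> V \<Longrightarrow> Ae (x - y) = Ae x - Ae y"
proof -
  show add: "y \<in> V \<Longrightarrow> A (x + y) = A x + A y" "y \<in> V \<Longrightarrow> As (x + y) = As x + As y"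
    "y \<in> V \<Longrightarrow> Ae (x + y) = Ae x + Ae y"
    and sc: "A (c *s x) = c *s A x" "As (c *s x) = c *s As x" "Ae (c *s x) = c *s Ae x"
    using assms linear_A linear_As linear_Ae by (auto simp: linear_map_def)
  show "A (x - y) = A x - A y" if "y \<in> V"
    using linear_A assms that maps_closed(4)[OF that, of "-1"] unfolding linear_map_def
    by (metis diff_conv_add_uminus scale_minus_left scale_one)
  show "Ae (x - y) = Ae x - Ae y" if "y \<in> V"
    using linear_Ae assms that maps_closed(4)[OF that, of "-1"] unfolding linear_map_def
    by (metis diff_conv_add_uminus scale_minus_left scale_one)
qed

text \<open>By the relations, \<open>As + \<theta>\<close> sends \<open>A x\<close> to
  \<open>k * \<mu>\<close> times \<open>Ae x\<close>, and \<open>Ae x\<close> to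
  \<open>\<mu> / k\<close> times \<open>A x\<close>. Adding or subtracting \<open>k\<close> times
  \<open>Ae x\<close> diagonalises this; \<open>\<epsilon>\<close> is the sign.\<close>

lemma ladder_eigenvector:
  assumes x: "x \<in> V" "As x = \<theta> *s x"
    and k: "\<mu> * \<zeta> = k" "k * \<mu> * \<zeta>e = 1" and \<epsilon>: "\<epsilon> * \<epsilon> = 1"
  defines "y \<equiv> A x + (\<epsilon> * k) *s Ae x"
  shows "As y = (\<epsilon> * \<mu> - \<theta>) *s y"
proof -
  note V = maps_closed[OF x(1)]
  have "(k * \<mu>) *s Ae x = (k * \<mu> * \<zeta>e) *s (A (As x) + As (A x))"
    using relations x(1) by (metis anticommutator_relations_def scale_scale)
  then have 1: "As (A x) = (k * \<mu>) *s Ae x - \<theta> *s A x"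
    using k(2) by (simp add: x maps_linear algebra_simps)
  have "(\<epsilon> * \<mu>) *s A x = (\<epsilon> * (\<mu> * \<zeta>)) *s (As (Ae x) + Ae (As x))"
    using relations x(1) by (metis anticommutator_relations_def scale_scale mult.assoc)
  then have 2: "(\<epsilon> * k) *s As (Ae x) = (\<epsilon> * \<mu>) *s A x - (\<epsilon> * k * \<theta>) *s Ae x"
    using k(1) by (simp add: x maps_linear algebra_simps)
  have "As y = As (A x) + (\<epsilon> * k) *s As (Ae x)"
    unfolding y_def using V by (simp add: maps_linear maps_closed)
  also have "\<dots> = (\<epsilon> * \<mu> - \<theta>) *s A x + ((\<epsilon> * \<epsilon>) * k * \<mu> - \<epsilon> * k * \<theta>) *s Ae x"
    unfolding 1 2 \<epsilon> by (simp add: algebra_simps)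
  also have "\<dots> = (\<epsilon> * \<mu> - \<theta>) *s y"
    unfolding y_def by (simp add: algebra_simps)
  finally show ?thesis .
qed

text \<open>In operator form, \<open>(A + c Ae)^2 = (A - c Ae)^2 + 2 c (Ae A + A Ae)\<close>; the
  third relation relates the last term to \<open>As\<close>.\<close>

lemma ladder_square:
  assumes "x \<in> V"
  shows "A (A x + c *s Ae x) + c *s Ae (A x + c *s Ae x) =
    A (A x - c *s Ae x) - c *s Ae (A x - c *s Ae x) + (2 * c) *s (Ae (A x) + A (Ae x))"
  using maps_closed[OF assms] by (simp add: maps_linear maps_closed algebra_simps flip: scale_left_distrib)

text \<open>The condition \<open>A x = k *s Ae x\<close> says that lowering kills \<open>x\<close>.
  Raising with alternating signs yields eigenvectors; lowering returns nonzero multiples of them, so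
  none vanishes up to index \<open>d\<close>. Sum and difference of the two operators recover
  \<open>A\<close> and \<open>Ae\<close> as tridiagonal maps.\<close>

lemma ladder_basis:
  assumes u: "is_basis scale V d u" and d: "even d"
    and k: "\<mu> * \<zeta> = k" "k * \<mu> * \<zeta>e = 1" and \<zeta>s: "\<zeta>s \<noteq> 0"
    and x: "x \<in> V" "x \<noteq> 0" "As x = (of_nat d / 2 * \<mu>) *s x" "A x = k *s Ae x"
  obtains w B Be where "is_basis scale V d w"
    "eigenvalues scale d w As (\<lambda>i. (-1) ^ i * (of_nat d / 2 - of_nat i) * \<mu>)"
    "represents scale d w A B" "irreducible_tridiagonal d B"
    "represents scale d w Ae Be" "irreducible_tridiagonal d Be"
proof -
  let ?\<phi> = "\<lambda>i. (-1) ^ i * (of_nat d / 2 - of_nat i) * \<mu>"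
  have k0: "k \<noteq> 0" "\<mu> \<noteq> 0" using k by auto
  \<comment> \<open>The sign \<open>(-1) ^ i\<close> is the one for which
    \<open>ladder_eigenvector\<close> leads from the \<open>i\<close>-th listed eigenvalue to the
    next.\<close>
  define w where "w = rec_nat x (\<lambda>i y. A y + ((-1) ^ i * k) *s Ae y)"
  \<comment> \<open>Solution of \<open>Q (Suc i) - Q i = k * \<mu> / \<zeta>s * (d - 2 * i)\<close>
    with \<open>Q 0 = 0\<close>, the recurrence arising in \<open>down\<close>.\<close>
  define Q :: "nat \<Rightarrow> 'k" where "Q i = k * \<mu> / \<zeta>s * of_nat i * (of_nat d + 1 - of_nat i)" for i
  have w0: "w 0 = x" and wS: "\<And>i. w (Suc i) = A (w i) + ((-1) ^ i * k) *s Ae (w i)"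
    unfolding w_def by simp_all
  have Vw: "w i \<in> V" for i
    by (induction i) (simp_all add: w0 wS x maps_closed subspace_add[OF subspace])
  have zero: "A 0 = 0" "Ae 0 = 0"
    using maps_linear(1,3)[OF Vw[of 0], of 0] by simp_all
  have eig: "As (w i) = ?\<phi> i *s w i" for i
  proof (induction i)
    case (Suc i)
    have "As (w (Suc i)) = ((-1) ^ i * \<mu> - ?\<phi> i) *s w (Suc i)"
      unfolding wS by (rule ladder_eigenvector[OF Vw Suc k]) (simp flip: power_add mult_2)
    then show ?case by (simp add: algebra_simps)
  qed (simp add: w0 x)
  \<comment> \<open>At \<open>i = 0\<close> the truncated index \<open>i - 1\<close> is again
    \<open>0\<close>; the coefficient \<open>Q 0 = 0\<close> removes that term.\<close>
  have down: "A (w i) - ((-1) ^ i * k) *s Ae (w i) = Q i *s w (i - 1)" for i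
  proof (induction i)
    case (Suc i)
    let ?e = "(-1) ^ i * k"
    \<comment> \<open>The sign flips with the index, so lowering \<open>w (Suc i)\<close> uses the
      operator that raised \<open>w i\<close>. Its square is traded by \<open>ladder_square\<close>
      for lowering \<open>w i\<close> and raising it back, plus a multiple of
      \<open>As (w i)\<close>.\<close>
    have "A (w (Suc i)) - ((-1) ^ Suc i * k) *s Ae (w (Suc i)) =
        A (A (w i) + ?e *s Ae (w i)) + ?e *s Ae (A (w i) + ?e *s Ae (w i))"
      unfolding wS by simp
    also have "\<dots> = A (A (w i) - ?e *s Ae (w i)) - ?e *s Ae (A (w i) - ?e *s Ae (w i)) +
        (2 * ?e) *s (Ae (A (w i)) + A (Ae (w i)))"
      by (rule ladder_square[OF Vw])
    also have "A (A (w i) - ?e *s Ae (w i)) - ?e *s Ae (A (w i) - ?e *s Ae (w i)) = Q i *s w i"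
    proof (cases i)
      case 0
      then show ?thesis unfolding Suc by (simp add: Q_def zero)
    next
      case (Suc j)
      then show ?thesis unfolding \<open>A (w i) - _ = _\<close>
        by (simp add: maps_linear Vw wS[of j] maps_closed algebra_simps)
    qed
    also have "Ae (A (w i)) + A (Ae (w i)) = (1 / \<zeta>s) *s As (w i)"
      using relations Vw[of i] \<zeta>s unfolding anticommutator_relations_def
      by (metis nonzero_divide_eq_eq scale_one scale_scale)
    also have "Q i *s w i + (2 * ?e) *s (1 / \<zeta>s) *s As (w i) = Q (Suc i) *s w i"
    proof -
      have "(-1) ^ i * (-1) ^ i = (1 :: 'k)" by (simp flip: power_add mult_2)
      then have "2 * ?e * (1 / \<zeta>s) * ?\<phi> i = k * \<mu> / \<zeta>s * (of_nat d - 2 * of_nat i)"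
        by (simp add: algebra_simps)
      then have "Q i + 2 * ?e * (1 / \<zeta>s) * ?\<phi> i = Q (Suc i)"
        by (simp add: Q_def algebra_simps add_divide_distrib diff_divide_distrib)
      then show ?thesis unfolding eig by (metis scale_left_distrib scale_scale)
    qed
    finally show ?case by simp
  qed (simp add: w0 x Q_def)
  have Q0: "Q (Suc i) \<noteq> 0" if "i < d" for i
  proof -
    have "Q (Suc i) = k * \<mu> / \<zeta>s * of_nat (Suc i) * of_nat (d - i)"
      using that by (simp add: Q_def of_nat_diff)
    then show ?thesis using that k0 \<zeta>s by (simp del: of_nat_Suc)
  qed
  have nz: "w i \<noteq> 0" if "i \<le> d" for i
    using that
  proof (induction i)
    case (Suc i)
    show ?case
    proof
      assume "w (Suc i) = 0"
      then have "Q (Suc i) *s w i = A 0 - ((-1) ^ Suc i * k) *s Ae 0"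
        using down[of "Suc i"] by simp
      also have "\<dots> = 0" by (simp add: zero)
      finally show False using Suc Q0[of i] by simp
    qed
  qed (simp add: w0 x)
  have inj: "inj_on ?\<phi> X" for X
    using inj_alternating[OF d k0(2)] by (rule inj_on_subset) simp
  \<comment> \<open>Otherwise \<open>d + 2\<close> eigenvectors with distinct eigenvalues would fit
    into dimension \<open>d + 1\<close>.\<close>
  have end0: "w (Suc d) = 0"
  proof (rule ccontr)
    assume "w (Suc d) \<noteq> 0"
    then have "\<And>i. i \<le> Suc d \<Longrightarrow> w i \<noteq> 0" using nz by (auto simp: le_Suc_eq)
    then have "Suc d \<le> d"
      by (intro no_longer_independent_family[OF u, of "Suc d" w]
          eigenvectors_independent[OF linear_As subspace Vw _ eig inj]) (auto intro: Vw)
    then show False by simp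
  qed
  have basis: "is_basis scale V d w"
    by (intro is_basis_if_independent_family[OF u]
        eigenvectors_independent[OF linear_As subspace Vw nz eig inj]) (auto intro: Vw)
  have Aw: "A (w j) = (1 / 2) *s w (Suc j) + (Q j / 2) *s w (j - 1)" for j
  proof -
    have "(Q j / 2) *s w (j - 1) = (1 / 2) *s (Q j *s w (j - 1))" by simp
    then have "(1 / 2) *s w (Suc j) + (Q j / 2) *s w (j - 1) = (1/2 + 1/2) *s A (w j)"
      unfolding down[symmetric] wS scale_left_distrib by (simp add: algebra_simps)
    then show ?thesis by simp
  qed
  have Aew: "Ae (w j) = ((-1) ^ j / (2 * k)) *s w (Suc j) + (- ((-1) ^ j * Q j / (2 * k))) *s w (j - 1)" for j
  proof -
    have e: "(-1) ^ j * (-1) ^ j = (1 :: 'k)" by (simp flip: power_add mult_2)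
    have "(- ((-1) ^ j * Q j / (2 * k))) *s w (j - 1) = (- ((-1) ^ j / (2 * k))) *s (Q j *s w (j - 1))" by simp
    then have "((-1) ^ j / (2 * k)) *s w (Suc j) + (- ((-1) ^ j * Q j / (2 * k))) *s w (j - 1)
      = (((-1) ^ j * (-1) ^ j) * (1/2 + 1/2)) *s Ae (w j)"
      unfolding down[symmetric] wS scale_left_distrib distrib_left using k0 by (simp add: algebra_simps)
    then show ?thesis unfolding e by simp
  qed
  have "represents scale d w A (tridiag (\<lambda>j. 1 / 2) (\<lambda>j. Q j / 2))"
    by (rule represents_tridiag, subst Aw) (use end0 in \<open>auto simp: Q_def le_less\<close>)
  moreover have "represents scale d w Ae (tridiag (\<lambda>j. (-1) ^ j / (2 * k)) (\<lambda>j. - ((-1) ^ j * Q j / (2 * k))))"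
    by (rule represents_tridiag, subst Aew) (use end0 in \<open>auto simp: Q_def le_less\<close>)
  ultimately show ?thesis
    using basis eig Q0 k0
    by (intro that[of w]) (auto simp: eigenvalues_def intro!: irreducible_tridiagonal_tridiag)
qed

end

section \<open>Normal form\<close>

context vector_space
begin

lemma is_basis_reverse:
  assumes "is_basis scale V n v"
  shows "is_basis scale V n (\<lambda>i. v (n - i))"
proof -
  have "bij_betw ((-) n) {..n} {..n}"
    by (rule bij_betwI[of _ _ _ "(-) n"]) auto
  then have "(\<lambda>i. v (n - i)) ` {..n} = v ` {..n}" "inj_on (\<lambda>i. v (n - i)) {..n} \<longleftrightarrow> inj_on v {..n}"
    using comp_inj_on_iff[of "(-) n" "{..n}" v] by (auto simp: bij_betw_def image_image[symmetric] comp_def)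
  then show ?thesis using assms unfolding is_basis_def by simp
qed

lemma represents_reverse:
  assumes "represents scale n v A B"
  shows "represents scale n (\<lambda>i. v (n - i)) A (\<lambda>i j. B (n - i) (n - j))"
  unfolding represents_def
proof (intro allI impI)
  fix j assume "j \<le> n"
  have "(\<Sum>i\<le>n. B (n - i) (n - j) *s v (n - i)) = (\<Sum>i\<le>n. B i (n - j) *s v i)"
    by (rule sum.reindex_bij_witness[of _ "(-) n" "(-) n"]) auto
  then show "A (v (n - j)) = (\<Sum>i\<le>n. B (n - i) (n - j) *s v (n - i))"
    using assms by (simp add: represents_def)
qed

lemma is_basis_rescale:
  assumes "is_basis scale V n v" "\<And>i. i \<le> n \<Longrightarrow> k i \<noteq> 0"
  shows "is_basis scale V n (\<lambda>i. k i *s v i)"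
proof (rule is_basis_if_independent_family[OF assms(1)])
  show "k i *s v i \<in> V" if "i \<le> n" for i
    using is_basis_mem[OF assms(1) that] is_basis_subspace[OF assms(1)] by (simp add: subspace_scale)
  fix a assume "(\<Sum>i\<le>n. a i *s (k i *s v i)) = 0"
  then have "\<forall>i\<le>n. a i * k i = 0"
    using assms(1)[unfolded is_basis_iff] by (auto dest!: spec[of _ "\<lambda>i. a i * k i"])
  then show "\<forall>i\<le>n. a i = 0" using assms(2) by auto
qed

lemma represents_rescale:
  assumes "represents scale n v A B" "is_basis scale V n v" "linear_map scale scale V V A"
    and "\<And>i. i \<le> n \<Longrightarrow> k i \<noteq> 0"
  shows "represents scale n (\<lambda>i. k i *s v i) A (\<lambda>i j. B i j * k j / k i)"
  unfolding represents_def
proof (intro allI impI)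
  fix j assume j: "j \<le> n"
  have "A (k j *s v j) = k j *s A (v j)"
    using assms(3) is_basis_mem[OF assms(2) j] by (simp add: linear_map_def)
  also have "\<dots> = (\<Sum>i\<le>n. (B i j * k j / k i) *s (k i *s v i))"
    using assms(1,4) j by (auto simp: represents_def scale_sum_right mult.commute intro!: sum.cong)
  finally show "A (k j *s v j) = (\<Sum>i\<le>n. (B i j * k j / k i) *s (k i *s v i))" .
qed

lemma represents_cong:
  assumes "\<And>i j. i \<le> n \<Longrightarrow> j \<le> n \<Longrightarrow> B i j = C i j"
  shows "represents scale n v A B \<longleftrightarrow> represents scale n v A C"
proof -
  have "(\<Sum>i\<le>n. B i j *s v i) = (\<Sum>i\<le>n. C i j *s v i)" if "j \<le> n" for j
    using assms that by (intro sum.cong) auto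
  then show ?thesis unfolding represents_def by metis
qed

end

context anticommuting_maps
begin

text \<open>Since \<open>\<theta> 0 + \<theta> 1\<close> equals \<open>c\<close> up to sign,
  reversing the basis if necessary makes them equal. Rescaling turns the subdiagonal into
  \<open>1\<close>; the superdiagonal then consists of the products of opposite entries, which
  rescaling leaves unchanged.\<close>

lemma normal_form:
  assumes v: "is_basis scale V n v" "eigenvalues scale n v A \<theta>" "represents scale n v As B"
    "irreducible_tridiagonal n B"
    and inj: "inj_on \<theta> {..n}"
    and n: "1 \<le> n" and diag: "\<And>i. i \<le> n \<Longrightarrow> B i i = 0"
    and c: "\<zeta>s * \<zeta>e * c\<^sup>2 = 1"
  obtains u where "is_basis scale V n u"
    "eigenvalues scale n u A (\<lambda>i. (-1) ^ i * (of_nat n / 2 - of_nat i) * c)"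
    "represents scale n u As (tridiag (\<lambda>_. 1) (\<lambda>j. of_nat j * of_nat (Suc n - j) / (4 * \<zeta> * \<zeta>e)))"
proof -
  let ?\<phi> = "\<lambda>i. (-1) ^ i * (of_nat n / 2 - of_nat i) * c"
  note par = bipartite_parameters[OF v inj n diag]
  have "(\<theta> 0 + \<theta> 1)\<^sup>2 = c\<^sup>2"
    using par(1) c by (metis mult_cancel_left mult_zero_left zero_neq_one)
  then have "\<theta> 0 + \<theta> 1 = c \<or> \<theta> 0 + \<theta> 1 = - c" by (simp add: power2_eq_iff)
  then obtain v' B' where v': "is_basis scale V n v'" "eigenvalues scale n v' A ?\<phi>"
    "represents scale n v' As B'" "irreducible_tridiagonal n B'" "\<And>i. i \<le> n \<Longrightarrow> B' i i = 0"
  proof (elim disjE)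
    assume "\<theta> 0 + \<theta> 1 = c"
    then have "eigenvalues scale n v A ?\<phi>"
      using v(2) par(4) unfolding eigenvalues_def by metis
    then show thesis by (rule that[OF v(1) _ v(3,4) diag])
  next
    assume *: "\<theta> 0 + \<theta> 1 = - c"
    have \<theta>: "\<theta> (n - i) = ?\<phi> i" if "i \<le> n" for i
    proof -
      \<comment> \<open>As \<open>n\<close> is even, reversal preserves the parity of an
        index.\<close>
      have e: "(-1) ^ (n - i) = ((-1) ^ i :: 'k)"
        using par(3) that by (simp add: minus_one_power_iff)
      have "\<theta> (n - i) = (-1) ^ i * (of_nat n / 2 - of_nat (n - i)) * (- c)"
        using par(4)[of "n - i", unfolded * e] by simp
      also have "\<dots> = ?\<phi> i"
        using that by (simp add: of_nat_diff algebra_simps flip: distrib_left)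
      finally show ?thesis .
    qed
    show thesis
    proof (rule that[OF is_basis_reverse[OF v(1)] _ represents_reverse[OF v(3)]])
      show "eigenvalues scale n (\<lambda>i. v (n - i)) A ?\<phi>"
        using v(2) \<theta> unfolding eigenvalues_def by (metis diff_le_self)
      show "irreducible_tridiagonal n (\<lambda>i j. B (n - i) (n - j))"
        unfolding irreducible_tridiagonal_def tridiagonal_def
      proof (intro conjI allI impI)
        fix i j assume "i \<le> n" "j \<le> n" "B (n - i) (n - j) \<noteq> 0"
        then have "n - i = n - j \<or> n - i = Suc (n - j) \<or> n - j = Suc (n - i)"
          using v(4) unfolding irreducible_tridiagonal_def tridiagonal_def by (meson diff_le_self)
        then show "i = j \<or> i = Suc j \<or> j = Suc i" using \<open>i \<le> n\<close> \<open>j \<le> n\<close> by linarith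
      next
        fix i assume i: "i < n"
        then have "n - i = Suc (n - Suc i)" "n - Suc i < n" by auto
        then show "B (n - Suc i) (n - i) \<noteq> 0" "B (n - i) (n - Suc i) \<noteq> 0"
          using v(4) unfolding irreducible_tridiagonal_def by metis+
      qed
    qed (simp add: diag)
  qed
  have "c \<noteq> 0" using c by auto
  then have inj': "inj_on ?\<phi> {..n}"
    using inj_alternating[OF par(3)] by (blast intro: inj_on_subset)
  note par' = bipartite_parameters[OF v'(1-4) inj' n v'(5)]
  \<comment> \<open>Cumulative products of the subdiagonal: \<open>k (Suc i) / k i\<close> is the
    entry to be normalised.\<close>
  define k where "k i = (\<Prod>l<i. B' (Suc l) l)" for i
  have k: "k i \<noteq> 0" if "i \<le> n" for i
    using v'(4) that unfolding k_def irreducible_tridiagonal_def by auto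
  have entries: "B' i j * k j / k i =
      tridiag (\<lambda>_. 1) (\<lambda>j. of_nat j * of_nat (Suc n - j) / (4 * \<zeta> * \<zeta>e)) i j"
    if ij: "i \<le> n" "j \<le> n" for i j
  proof -
    consider "i = Suc j" | "j = Suc i" | "i \<noteq> Suc j" "j \<noteq> Suc i" by auto
    then show ?thesis
    proof cases
      case 1
      then have "k i = k j * B' (Suc j) j" by (simp add: k_def)
      then show ?thesis using 1 k[OF ij(1)] by (simp add: tridiag_def)
    next
      case 2
      then have "k j = k i * B' (Suc i) i" by (simp add: k_def)
      then show ?thesis using 2 k[OF ij(1)] par'(5)[of i] ij by (simp add: tridiag_def mult_ac)
    next
      case 3
      then have "B' i j = 0"
        using v'(4,5) ij unfolding irreducible_tridiagonal_def tridiagonal_def by metis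
      then show ?thesis using 3 by (simp add: tridiag_def)
    qed
  qed
  show thesis
  proof (rule that)
    show "is_basis scale V n (\<lambda>i. k i *s v' i)" by (rule is_basis_rescale[OF v'(1) k])
    show "eigenvalues scale n (\<lambda>i. k i *s v' i) A ?\<phi>"
      using v'(2) is_basis_mem[OF v'(1)] unfolding eigenvalues_def by (simp add: maps_linear mult.commute)
    have "represents scale n (\<lambda>i. k i *s v' i) As (\<lambda>i j. B' i j * k j / k i)"
      by (rule represents_rescale[OF v'(3,1) linear_As k])
    then show "represents scale n (\<lambda>i. k i *s v' i) As
        (tridiag (\<lambda>_. 1) (\<lambda>j. of_nat j * of_nat (Suc n - j) / (4 * \<zeta> * \<zeta>e)))"
      by (rule represents_cong[THEN iffD1, rotated]) (rule entries)
  qed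
qed

end

text \<open>The isomorphism identifies coordinates in \<open>v\<close> with coordinates in
  \<open>w\<close>; equal matrices make it intertwine the maps.\<close>

lemma leonard_triple_iso_if_same_matrices:
  assumes s: "vector_space s" and t: "vector_space t"
    and v: "is_basis s V n v" and w: "is_basis t W n w"
    and A: "linear_map s s V V A" "represents s n v A D" "linear_map t t W W B" "represents t n w B D"
    and As: "linear_map s s V V As" "represents s n v As Ds" "linear_map t t W W Bs" "represents t n w Bs Ds"
    and Ae: "linear_map s s V V Ae" "represents s n v Ae De" "linear_map t t W W Be" "represents t n w Be De"
  shows "leonard_triple_iso s V A As Ae t W B Bs Be"
proof -
  interpret S: vector_space s by fact
  interpret T: vector_space t by fact
  have "\<forall>x\<in>V. \<exists>a. x = (\<Sum>i\<le>n. s (a i) (v i))"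
    using S.is_basis_expand[OF v] by metis
  then obtain co where co: "\<And>x. x \<in> V \<Longrightarrow> x = (\<Sum>i\<le>n. s (co x i) (v i))" by metis
  define \<phi> where "\<phi> x = (\<Sum>i\<le>n. t (co x i) (w i))" for x
  have mem: "(\<Sum>i\<le>n. s (a i) (v i)) \<in> V" for a
    using v unfolding S.is_basis_iff by auto
  have co_comb: "co (\<Sum>i\<le>n. s (a i) (v i)) i = a i" if "i \<le> n" for a i
    using S.is_basis_unique[OF v co[OF mem, of a, symmetric] that] .
  have \<phi>: "\<phi> (\<Sum>i\<le>n. s (a i) (v i)) = (\<Sum>i\<le>n. t (a i) (w i))" for a
    unfolding \<phi>_def by (intro sum.cong) (simp_all add: co_comb)
  have intertwine: "\<phi> (X x) = Y (\<phi> x)"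
    if X: "linear_map s s V V X" "represents s n v X M" and Y: "linear_map t t W W Y" "represents t n w Y M"
      and x: "x \<in> V" for X Y M x
  proof -
    obtain a where a: "x = (\<Sum>i\<le>n. s (a i) (v i))" using co[OF x] by blast
    show ?thesis
      unfolding a \<phi> S.represents_apply[OF v X] T.represents_apply[OF w Y] ..
  qed
  have W: "W = range (\<lambda>a. \<Sum>i\<le>n. t (a i) (w i))"
    using w unfolding T.is_basis_iff by blast
  have "linear_map s t V W \<phi>"
    unfolding linear_map_def
  proof (intro conjI ballI allI)
    fix x assume x: "x \<in> V"
    show "\<phi> x \<in> W" unfolding \<phi>_def W by blast
    show "\<phi> (x + y) = \<phi> x + \<phi> y" if y: "y \<in> V" for y
    proof -
      have "x + y = (\<Sum>i\<le>n. s (co x i + co y i) (v i))"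
        using co[OF x] co[OF y] by (simp add: S.scale_left_distrib sum.distrib)
      then have "\<phi> (x + y) = (\<Sum>i\<le>n. t (co x i + co y i) (w i))" by (simp only: \<phi>)
      then show ?thesis by (simp add: \<phi>_def T.scale_left_distrib sum.distrib)
    qed
    show "\<phi> (s c x) = t c (\<phi> x)" for c
    proof -
      have "s c x = (\<Sum>i\<le>n. s (c * co x i) (v i))"
        using arg_cong[OF co[OF x], of "s c"] by (simp add: S.scale_sum_right)
      then have "\<phi> (s c x) = (\<Sum>i\<le>n. t (c * co x i) (w i))" by (simp only: \<phi>)
      then show ?thesis by (simp add: \<phi>_def T.scale_sum_right)
    qed
  qed
  moreover have "bij_betw \<phi> V W"
    unfolding bij_betw_def
  proof
    show "inj_on \<phi> V"
    proof (rule inj_onI)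
      fix x y assume "x \<in> V" "y \<in> V" "\<phi> x = \<phi> y"
      then have "\<And>i. i \<le> n \<Longrightarrow> co x i = co y i"
        using T.is_basis_unique[OF w] unfolding \<phi>_def by blast
      then have "(\<Sum>i\<le>n. s (co x i) (v i)) = (\<Sum>i\<le>n. s (co y i) (v i))" by simp
      then show "x = y" using co \<open>x \<in> V\<close> \<open>y \<in> V\<close> by metis
    qed
    show "\<phi> ` V = W"
    proof
      show "\<phi> ` V \<subseteq> W" unfolding \<phi>_def W by blast
      show "W \<subseteq> \<phi> ` V" unfolding W using \<phi>[symmetric] mem by blast
    qed
  qed
  ultimately show ?thesis
    using intertwine[OF A] intertwine[OF As] intertwine[OF Ae] unfolding leonard_triple_iso_def by blast
qed

section \<open>Existence\<close>

lemma (in vector_space) standard_basisI: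
  assumes "is_basis scale V d v" "eigenvalues scale d v A \<theta>"
    and "\<And>X. X \<in> S \<Longrightarrow> \<exists>B. represents scale d v X B \<and> irreducible_tridiagonal d B"
  shows "standard_basis scale V A S v"
proof -
  have "diagonal d (\<lambda>i j. if i = j then \<theta> i else 0)"
    by (simp add: diagonal_def)
  then show ?thesis
    using assms is_basis_diameter[OF assms(1)]
    unfolding standard_basis_def eigenvalues_iff_represents by blast
qed

context anticommuting_maps
begin

lemma bipartite_in_standard_bases:
  assumes u: "is_basis scale V d u" "eigenvalues scale d u A (\<lambda>i. (-1) ^ i * (of_nat d / 2 - of_nat i) * \<mu>)"
    and \<mu>: "\<zeta>s * \<zeta>e * \<mu>\<^sup>2 = 1" and d: "even d"
  shows "bipartite_in_standard_bases scale V A {As, Ae}"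
  unfolding bipartite_in_standard_bases_def
proof (intro allI impI ballI)
  interpret sw: anticommuting_maps scale V A Ae As \<zeta> \<zeta>e \<zeta>s by (rule swap)
  fix v X B
  assume v: "standard_basis scale V A {As, Ae} v" and X: "X \<in> {As, Ae}"
    and B: "represents scale (diameter scale V) v X B"
  let ?n = "diameter scale V"
  obtain \<theta> where \<theta>: "eigenvalues scale ?n v A \<theta>" by (rule standard_basis_eigenvalues[OF v])
  have basis: "is_basis scale V ?n v" using v by (simp add: standard_basis_def)
  obtain C where C: "represents scale ?n v X C" "irreducible_tridiagonal ?n C"
    using v X unfolding standard_basis_def by blast
  have "tridiagonal ?n B"
    using C(2) represents_unique[OF basis B C(1)] unfolding irreducible_tridiagonal_def tridiagonal_def
    by metis
  moreover have "B i i = 0" if "i \<le> ?n" for i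
    using X
  proof (elim insertE emptyE)
    assume "X = As"
    then show ?thesis using zero_diagonal[OF u \<mu> d basis \<theta> _ that] B by blast
  next
    assume "X = Ae"
    moreover have "\<zeta>e * \<zeta>s * \<mu>\<^sup>2 = 1" using \<mu> by (simp add: mult.commute)
    ultimately show ?thesis using sw.zero_diagonal[OF u _ d basis \<theta> _ that] B by blast
  qed
  ultimately show "bipartite ?n B" by (simp add: bipartite_def)
qed

text \<open>One extremal eigenvector supplies everything required of \<open>As\<close> in a totally
  bipartite triple; rotating the maps transfers this to \<open>Ae\<close> and
  \<open>A\<close>.\<close>

lemma ladder_standard_basis:
  assumes u: "is_basis scale V d u" and d: "even d"
    and k: "\<mu> * \<zeta> = k" "k * \<mu> * \<zeta>e = 1" and \<zeta>s: "\<zeta>s \<noteq> 0"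
    and x: "x \<in> V" "x \<noteq> 0" "As x = (of_nat d / 2 * \<mu>) *s x" "A x = k *s Ae x"
  shows "\<exists>w. standard_basis scale V As {Ae, A} w" "bipartite_in_standard_bases scale V As {Ae, A}"
proof -
  interpret rot: anticommuting_maps scale V As Ae A \<zeta>s \<zeta>e \<zeta> by (rule rotate)
  obtain w B Be where w: "is_basis scale V d w"
    "eigenvalues scale d w As (\<lambda>i. (-1) ^ i * (of_nat d / 2 - of_nat i) * \<mu>)"
    "represents scale d w A B" "irreducible_tridiagonal d B"
    "represents scale d w Ae Be" "irreducible_tridiagonal d Be"
    by (rule ladder_basis[OF assms])
  show "\<exists>w. standard_basis scale V As {Ae, A} w"
    using standard_basisI[OF w(1,2), of "{Ae, A}"] w(3-6) by blast
  have "\<zeta>e * \<zeta> * \<mu>\<^sup>2 = 1"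
    using k(2) unfolding k(1)[symmetric] by (simp add: power2_eq_square mult_ac)
  then show "bipartite_in_standard_bases scale V As {Ae, A}"
    by (rule rot.bipartite_in_standard_bases[OF w(1,2) _ d])
qed

lemma leonard_triple_bannai_ito:
  assumes "fin_dim_space scale V" "3 \<le> diameter scale V"
    and v: "standard_basis scale V A {As, Ae} v" "standard_basis scale V As {Ae, A} w"
      "standard_basis scale V Ae {A, As} u"
  shows "leonard_triple_bannai_ito scale V A As Ae"
proof -
  \<comment> \<open>With the ambient locale these interpretations give the six orders of the maps,
    one for each Leonard pair.\<close>
  interpret r: anticommuting_maps scale V As Ae A \<zeta>s \<zeta>e \<zeta> by (rule rotate)
  interpret rr: anticommuting_maps scale V Ae A As \<zeta>e \<zeta> \<zeta>s by (rule r.rotate)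
  interpret s: anticommuting_maps scale V A Ae As \<zeta> \<zeta>e \<zeta>s by (rule swap)
  interpret rs: anticommuting_maps scale V As A Ae \<zeta>s \<zeta> \<zeta>e by (rule r.swap)
  interpret rrs: anticommuting_maps scale V Ae As A \<zeta>e \<zeta>s \<zeta> by (rule rr.swap)
  show ?thesis
    unfolding leonard_triple_bannai_ito_def leonard_triple_def
    using assms linear_A linear_As linear_Ae
      leonard_pair_bannai_ito[OF assms(1,2) v(1) _ v(2)] rs.leonard_pair_bannai_ito[OF assms(1,2) v(2) _ v(1)]
      r.leonard_pair_bannai_ito[OF assms(1,2) v(2) _ v(3)] rrs.leonard_pair_bannai_ito[OF assms(1,2) v(3) _ v(2)]
      rr.leonard_pair_bannai_ito[OF assms(1,2) v(3) _ v(1)] s.leonard_pair_bannai_ito[OF assms(1,2) v(1) _ v(3)]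
    by blast
qed

end

section \<open>An explicit triple on sequences supported on indices up to \<open>d\<close>\<close>

lemma sum_fun_apply: "(\<Sum>i\<in>I. f i) x = (\<Sum>i\<in>I. f i x)"
  for f :: "'i \<Rightarrow> 'a \<Rightarrow> 'b::comm_monoid_add"
  by (induction I rule: infinite_finite_induct) auto

lemma vector_space_seq_scale: "vector_space seq_scale"
  by unfold_locales (auto simp: seq_scale_def fun_eq_iff algebra_simps)

text \<open>The scalars \<open>c\<close> and \<open>\<nu>\<close> scale the eigenvalues of
  \<open>A\<close> and \<open>As\<close>. Keeping these square roots as parameters postpones
  algebraic closure to the instantiation.\<close>

locale krawtchouk_model =
  fixes d :: nat and \<zeta> \<zeta>s \<zeta>e c \<nu> :: "'k::field_char_0"
  assumes c: "\<zeta>s * \<zeta>e * c\<^sup>2 = 1" and \<nu>: "\<zeta> * \<zeta>e * \<nu>\<^sup>2 = 1"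
begin

definition V :: "(nat \<Rightarrow> 'k) set" where
  "V = {f. \<forall>i>d. f i = 0}"

text \<open>As \<open>\<nu>\<^sup>2 = 1 / (\<zeta> * \<zeta>e)\<close>, this is the superdiagonal
  entry of the normal form in column \<open>Suc j\<close>. Subtraction in the field makes it vanish
  at \<open>j = d\<close>.\<close>

definition p :: "nat \<Rightarrow> 'k" where
  "p j = of_nat (Suc j) * (of_nat d - of_nat j) * \<nu>\<^sup>2 / 4"

definition shift :: "(nat \<Rightarrow> 'k) \<Rightarrow> nat \<Rightarrow> 'k" where
  "shift f j = (case j of 0 \<Rightarrow> 0 | Suc i \<Rightarrow> f i)"

definition A :: "(nat \<Rightarrow> 'k) \<Rightarrow> nat \<Rightarrow> 'k" where
  "A f j = (-1) ^ j * (of_nat d / 2 - of_nat j) * c * f j"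

definition As :: "(nat \<Rightarrow> 'k) \<Rightarrow> nat \<Rightarrow> 'k" where
  "As f j = (if j \<le> d then p j * f (Suc j) + shift f j else 0)"

text \<open>The entries are those prescribed by \<open>represents_Ae\<close>: in row
  \<open>j\<close> the two sums of neighbouring eigenvalues of \<open>A\<close> are \<open>c\<close>
  and \<open>- c\<close> up to a common sign.\<close>

definition Ae :: "(nat \<Rightarrow> 'k) \<Rightarrow> nat \<Rightarrow> 'k" where
  "Ae f j = (if j \<le> d then \<zeta>e * c * (-1) ^ j * (p j * f (Suc j) - shift f j) else 0)"

lemma nonzero: "\<zeta> \<noteq> 0" "\<zeta>s \<noteq> 0" "\<zeta>e \<noteq> 0" "c \<noteq> 0" "\<nu> \<noteq> 0"
  using c \<nu> by auto

sublocale vector_space seq_scale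
  by (rule vector_space_seq_scale)

lemma subspace_V: "subspace V"
  by (rule subspaceI) (auto simp: V_def seq_scale_def)

lemma basis: "is_basis seq_scale V d (\<lambda>i j. if j = i then 1 else 0)"
proof -
  have *: "(\<Sum>i\<le>d. seq_scale (a i) (\<lambda>j. if j = i then 1 else 0)) = (\<lambda>j. if j \<le> d then a j else 0)" for a
    by (rule ext) (auto simp: sum_fun_apply seq_scale_def if_distrib[of "(*) _"] sum.delta cong: if_cong)
  show ?thesis
    unfolding is_basis_iff *
  proof (intro conjI allI impI)
    fix a i assume "(\<lambda>j. if j \<le> d then a j else 0) = (0 :: nat \<Rightarrow> 'k)" "i \<le> d"
    then show "a i = 0" by (auto dest!: fun_cong[of _ _ i])
  next
    have "f = (\<lambda>j. if j \<le> d then f j else 0)" if "f \<in> V" for f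
      using that by (auto simp: V_def)
    then show "V = range (\<lambda>a j. if j \<le> d then a j else 0)"
      by (auto simp: V_def)
  qed
qed

lemma linear_maps: "linear_map seq_scale seq_scale V V A" "linear_map seq_scale seq_scale V V As"
  "linear_map seq_scale seq_scale V V Ae"
  by (auto simp: linear_map_def V_def A_def As_def Ae_def seq_scale_def shift_def fun_eq_iff
      algebra_simps split: nat.split)

lemma p_diff: "4 * p (Suc j) - 4 * p j = (of_nat d - 2 * of_nat j - 2) * \<nu>\<^sup>2"
  by (simp add: p_def field_simps)

lemma p_last: "p d = 0"
  by (simp add: p_def)

lemma A_up: "p j * A f (Suc j) = (-1) ^ Suc j * (of_nat d / 2 - of_nat (Suc j)) * c * (p j * f (Suc j))"
  by (simp add: A_def)

lemma A_down: "shift (A f) j = (-1) ^ Suc j * (of_nat d / 2 - of_nat j + 1) * c * shift f j"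
  by (cases j) (simp_all add: shift_def A_def)

lemma A_As:
  assumes "j \<le> d"
  shows "A (As f) j + As (A f) j = c * (-1) ^ j * (p j * f (Suc j) - shift f j)"
  unfolding As_def[of "A f"] A_up A_down using assms
  by (simp add: As_def A_def algebra_simps)

lemma A_Ae:
  assumes "j \<le> d"
  shows "\<zeta>s * (A (Ae f) j + Ae (A f) j) = As f j"
proof -
  have "A (Ae f) j + Ae (A f) j =
      \<zeta>e * c\<^sup>2 * ((-1) ^ j * (-1) ^ j) * (p j * f (Suc j) + shift f j)"
    unfolding Ae_def[of "A f"] A_up A_down using assms
    by (simp add: Ae_def A_def power2_eq_square algebra_simps)
  also have "(-1) ^ j * (-1) ^ j = (1 :: 'k)" by (simp flip: power_add mult_2)
  finally have "\<zeta>s * (A (Ae f) j + Ae (A f) j) = (\<zeta>s * \<zeta>e * c\<^sup>2) * (p j * f (Suc j) + shift f j)"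
    by (simp add: mult_ac)
  then show ?thesis using c assms by (simp add: As_def)
qed

lemma As_Ae:
  assumes "j \<le> d"
  shows "\<zeta> * (As (Ae f) j + Ae (As f) j) = A f j"
proof -
  \<comment> \<open>The default \<open>0\<close> in \<open>g\<close> and \<open>q\<close> lets one
    computation also cover \<open>j = 0\<close>; at the other end \<open>p d = 0\<close> does
    so.\<close>
  define g where "g = (case j of 0 \<Rightarrow> 0 | Suc i \<Rightarrow> shift f i)"
  define q where "q = (case j of 0 \<Rightarrow> 0 | Suc i \<Rightarrow> p i)"
  have up: "p j * Ae f (Suc j) = p j * (\<zeta>e * c * (-1) ^ Suc j * (p (Suc j) * f (Suc (Suc j)) - f j))"
    "p j * As f (Suc j) = p j * (p (Suc j) * f (Suc (Suc j)) + f j)"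
    using p_last assms by (auto simp: Ae_def As_def shift_def not_le less_Suc_eq_le)
  have dn: "shift (Ae f) j = \<zeta>e * c * (-1) ^ Suc j * (q * f j - g)" "shift (As f) j = q * f j + g"
    using assms by (auto simp: shift_def Ae_def As_def q_def g_def split: nat.split)
  \<comment> \<open>The terms two places away cancel, leaving a first difference of \<open>p\<close>
    on the diagonal.\<close>
  have "As (Ae f) j + Ae (As f) j = 2 * \<zeta>e * c * (-1) ^ j * (p j - q) * f j"
    unfolding As_def[of "Ae f"] Ae_def[of "As f"] up dn right_diff_distrib[of _ "p j * As f (Suc j)"]
    using assms by (simp add: algebra_simps)
  also have "p j - q = (of_nat d - 2 * of_nat j) * \<nu>\<^sup>2 / 4"
    using p_diff[of "j - 1"] by (cases j) (simp_all add: q_def p_def field_simps)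
  finally have sum: "As (Ae f) j + Ae (As f) j =
      2 * \<zeta>e * c * (-1) ^ j * ((of_nat d - 2 * of_nat j) * \<nu>\<^sup>2 / 4) * f j" .
  have "\<zeta> * (As (Ae f) j + Ae (As f) j) =
      (\<zeta> * \<zeta>e * \<nu>\<^sup>2) * ((-1) ^ j * (of_nat d / 2 - of_nat j) * c * f j)"
    unfolding sum by (simp add: field_simps)
  then show ?thesis unfolding \<nu> by (simp add: A_def)
qed

sublocale anticommuting_maps seq_scale V A As Ae \<zeta> \<zeta>s \<zeta>e
proof
  show "anticommutator_relations seq_scale V \<zeta> \<zeta>s \<zeta>e A As Ae"
    unfolding anticommutator_relations_def
  proof (intro ballI conjI ext)
    fix f j assume f: "f \<in> V"
    show "seq_scale \<zeta>e (A (As f) + As (A f)) j = Ae f j"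
      "seq_scale \<zeta> (As (Ae f) + Ae (As f)) j = A f j"
      "seq_scale \<zeta>s (Ae (A f) + A (Ae f)) j = As f j"
      using f A_As[of j f] As_Ae[of j f] A_Ae[of j f]
      by (cases "j \<le> d"; simp add: seq_scale_def add.commute; simp add: A_def As_def Ae_def V_def)+
  qed
qed (fact subspace_V linear_maps)+

text \<open>
  Truncated to indices up to \<open>d\<close>, this is an extremal eigenvector of \<open>As\<close> for \<open>\<sigma> = 1\<close> and of \<open>Ae\<close> for
  \<open>\<sigma> = -1\<close>.
\<close>

primrec kernel :: "'k \<Rightarrow> nat \<Rightarrow> 'k" where
  "kernel \<sigma> 0 = 1"
| "kernel \<sigma> (Suc j) = \<sigma> ^ j * kernel \<sigma> j * (2 / \<nu>) / of_nat (Suc j)"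

definition start :: "'k \<Rightarrow> nat \<Rightarrow> 'k" where
  "start \<sigma> j = (if j \<le> d then kernel \<sigma> j else 0)"

lemma start: "start \<sigma> \<in> V" "start \<sigma> \<noteq> 0"
  by (auto simp: start_def V_def dest!: fun_cong[of _ _ 0])

text \<open>The recurrence of \<open>kernel\<close> is chosen so that each off-diagonal contribution
  is a multiple of the entry at \<open>j\<close> itself.\<close>

lemma start_up: "j \<le> d \<Longrightarrow> p j * start \<sigma> (Suc j) = \<sigma> ^ j * (of_nat d - of_nat j) * \<nu> / 2 * start \<sigma> j"
proof (cases "j = d")
  case False
  assume "j \<le> d"
  with False nonzero show ?thesis
    by (simp add: start_def p_def power2_eq_square field_simps del: of_nat_Suc)
qed (simp add: p_last)

lemma start_down:
  assumes "\<sigma> * \<sigma> = 1" "j \<le> d"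
  shows "shift (start \<sigma>) j = \<sigma> * \<sigma> ^ j * of_nat j * \<nu> / 2 * start \<sigma> j"
proof (cases j)
  case (Suc i)
  have "\<sigma> * \<sigma> ^ j * of_nat j * \<nu> / 2 * start \<sigma> j = (\<sigma> * \<sigma>) ^ Suc i * start \<sigma> i"
    using Suc assms(2) nonzero
    by (simp add: start_def power_mult_distrib field_simps del: of_nat_Suc)
  then show ?thesis using Suc assms(1) by (simp add: shift_def)
qed (simp add: shift_def)

text \<open>For \<open>\<sigma> = 1\<close> the factor in \<open>As\<close> is constant; for
  \<open>\<sigma> = -1\<close> the powers of \<open>-1\<close> in \<open>Ae\<close> cancel and leave
  a constant factor there.\<close>

lemma start_As:
  assumes "\<sigma> * \<sigma> = 1" "j \<le> d"
  shows "As (start \<sigma>) j = \<sigma> ^ j * (of_nat d - (1 - \<sigma>) * of_nat j) * \<nu> / 2 * start \<sigma> j"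
    and "Ae (start \<sigma>) j =
      \<zeta>e * c * (-1) ^ j * (\<sigma> ^ j * (of_nat d - (1 + \<sigma>) * of_nat j) * \<nu> / 2 * start \<sigma> j)"
  using assms(2) unfolding As_def Ae_def start_up[OF assms(2)] start_down[OF assms]
  by (simp_all add: field_simps)

lemma totally_bipartite_bannai_ito:
  assumes d: "even d" "3 \<le> d"
  shows "totally_bipartite_leonard_triple seq_scale V A As Ae"
    "leonard_triple_bannai_ito seq_scale V A As Ae"
    "diameter seq_scale V = d"
proof -
  interpret r: anticommuting_maps seq_scale V As Ae A \<zeta>s \<zeta>e \<zeta> by (rule rotate)
  interpret rr: anticommuting_maps seq_scale V Ae A As \<zeta>e \<zeta> \<zeta>s by (rule r.rotate)
  show diam: "diameter seq_scale V = d" by (rule is_basis_diameter[OF basis])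
  have fin: "fin_dim_space seq_scale V" by (rule is_basis_fin_dim_space[OF basis])
  have sq: "(-1) ^ j * (-1) ^ j = (1 :: 'k)" for j by (simp flip: power_add mult_2)
  \<comment> \<open>Each map needs an extremal eigenvector to start its ladder: \<open>?e\<close>
    for \<open>A\<close>, \<open>start 1\<close> for \<open>As\<close> and \<open>start (-1)\<close>
    for \<open>Ae\<close>.\<close>
  let ?e = "\<lambda>j. if j = 0 then 1 else (0 :: 'k)"
  have shift_e: "shift ?e j = (if j = 1 then 1 else 0)" for j
    by (cases j) (auto simp: shift_def)
  have A: "\<exists>v. standard_basis seq_scale V A {As, Ae} v" "bipartite_in_standard_bases seq_scale V A {As, Ae}"
  proof -
    have "c * \<zeta>e = c * \<zeta>e" "c * \<zeta>e * c * \<zeta>s = 1"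
      using c by (simp_all add: power2_eq_square mult_ac)
    moreover have "?e \<in> V" "?e \<noteq> 0" by (auto simp: V_def dest!: fun_cong[of _ _ 0])
    moreover have "A ?e = seq_scale (of_nat d / 2 * c) ?e"
      by (rule ext) (simp add: A_def seq_scale_def)
    moreover have "Ae ?e = seq_scale (c * \<zeta>e) (As ?e)"
      by (rule ext) (simp add: Ae_def As_def seq_scale_def shift_e)
    ultimately show "\<exists>v. standard_basis seq_scale V A {As, Ae} v"
      "bipartite_in_standard_bases seq_scale V A {As, Ae}"
      using rr.ladder_standard_basis[OF basis d(1), of c "c * \<zeta>e" ?e] nonzero by blast+
  qed
  have As: "\<exists>v. standard_basis seq_scale V As {Ae, A} v" "bipartite_in_standard_bases seq_scale V As {Ae, A}"
  proof -
    have "\<nu> * \<zeta> = \<nu> * \<zeta>" and k: "\<nu> * \<zeta> * \<nu> * \<zeta>e = 1"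
      using \<nu> by (simp_all add: power2_eq_square mult_ac)
    moreover have "As (start 1) = seq_scale (of_nat d / 2 * \<nu>) (start 1)"
    proof (rule ext)
      fix j show "As (start 1) j = seq_scale (of_nat d / 2 * \<nu>) (start 1) j"
        by (cases "j \<le> d") (simp_all add: start_As seq_scale_def, simp add: As_def start_def)
    qed
    moreover have "A (start 1) = seq_scale (\<nu> * \<zeta>) (Ae (start 1))"
    proof (rule ext)
      fix j
      show "A (start 1) j = seq_scale (\<nu> * \<zeta>) (Ae (start 1)) j"
      proof (cases "j \<le> d")
        case True
        then have "seq_scale (\<nu> * \<zeta>) (Ae (start 1)) j =
            (\<nu> * \<zeta> * \<nu> * \<zeta>e) * (c * (-1) ^ j * ((of_nat d - 2 * of_nat j) / 2 * start 1 j))"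
          by (simp add: start_As seq_scale_def)
        then show ?thesis unfolding k by (simp add: A_def field_simps)
      qed (simp add: A_def Ae_def start_def seq_scale_def)
    qed
    ultimately show "\<exists>v. standard_basis seq_scale V As {Ae, A} v"
      "bipartite_in_standard_bases seq_scale V As {Ae, A}"
      using ladder_standard_basis[OF basis d(1), of \<nu> "\<nu> * \<zeta>" "start 1"] nonzero start by blast+
  qed
  have Ae: "\<exists>v. standard_basis seq_scale V Ae {A, As} v" "bipartite_in_standard_bases seq_scale V Ae {A, As}"
  proof -
    let ?\<mu> = "\<zeta>e * c * \<nu>"
    have "?\<mu> * \<zeta>s = ?\<mu> * \<zeta>s" ..
    moreover have "?\<mu> * \<zeta>s * ?\<mu> * \<zeta> = 1"
    proof -
      have "?\<mu> * \<zeta>s * ?\<mu> * \<zeta> = (\<zeta>s * \<zeta>e * c\<^sup>2) * (\<zeta> * \<zeta>e * \<nu>\<^sup>2)"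
        by (simp add: power2_eq_square mult_ac)
      then show ?thesis unfolding c \<nu> by simp
    qed
    moreover have "Ae (start (-1)) = seq_scale (of_nat d / 2 * ?\<mu>) (start (-1))"
    proof (rule ext)
      fix j
      show "Ae (start (-1)) j = seq_scale (of_nat d / 2 * ?\<mu>) (start (-1)) j"
      proof (cases "j \<le> d")
        case True
        then have "Ae (start (-1)) j = ((-1) ^ j * (-1) ^ j) * (of_nat d / 2 * ?\<mu> * start (-1) j)"
          by (simp add: start_As)
        then show ?thesis unfolding sq by (simp add: seq_scale_def)
      qed (simp add: Ae_def start_def seq_scale_def)
    qed
    moreover have "As (start (-1)) = seq_scale (?\<mu> * \<zeta>s) (A (start (-1)))"
    proof (rule ext)
      fix j
      show "As (start (-1)) j = seq_scale (?\<mu> * \<zeta>s) (A (start (-1))) j"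
      proof (cases "j \<le> d")
        case True
        have "seq_scale (?\<mu> * \<zeta>s) (A (start (-1))) j =
            (\<zeta>s * \<zeta>e * c\<^sup>2) * ((-1) ^ j * (of_nat d / 2 - of_nat j) * \<nu> * start (-1) j)"
          by (simp add: A_def seq_scale_def power2_eq_square)
        then show ?thesis unfolding c using True by (simp add: start_As field_simps)
      qed (simp add: A_def As_def start_def seq_scale_def)
    qed
    ultimately show "\<exists>v. standard_basis seq_scale V Ae {A, As} v"
      "bipartite_in_standard_bases seq_scale V Ae {A, As}"
      using r.ladder_standard_basis[OF basis d(1), of ?\<mu> "?\<mu> * \<zeta>s" "start (-1)"] nonzero start by blast+
  qed
  obtain u v w where "standard_basis seq_scale V A {As, Ae} u"
    "standard_basis seq_scale V As {Ae, A} v" "standard_basis seq_scale V Ae {A, As} w"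
    using A(1) As(1) Ae(1) by blast
  then show "leonard_triple_bannai_ito seq_scale V A As Ae"
    using leonard_triple_bannai_ito[OF fin] d(2) by (simp add: diam)
  then show "totally_bipartite_leonard_triple seq_scale V A As Ae"
    using A(2) As(2) Ae(2)
    unfolding totally_bipartite_leonard_triple_def leonard_triple_bannai_ito_def by blast
qed

end

section \<open>The equivalence and uniqueness\<close>

text \<open>Distinctness of the eigenvalues of \<open>A\<close> comes from a standard basis of
  \<open>As\<close>. The last conclusion holds for every root \<open>c\<close>, so two triples can
  share one choice of it.\<close>

lemma totally_bipartite_triple_structure:
  fixes s :: "'k::field_char_0 \<Rightarrow> 'v::ab_group_add \<Rightarrow> 'v"
  assumes triple: "totally_bipartite_leonard_triple s V A As Ae"
    and rel: "anticommutator_relations s V \<zeta> \<zeta>s \<zeta>e A As Ae"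
    and d: "diameter s V = d" "1 \<le> d"
  shows "anticommuting_maps s V A As Ae \<zeta> \<zeta>s \<zeta>e"
    and "even d" "\<zeta> \<noteq> 0" "\<zeta>s \<noteq> 0" "\<zeta>e \<noteq> 0"
    and "\<And>c. \<zeta>s * \<zeta>e * c\<^sup>2 = 1 \<Longrightarrow> \<exists>u. is_basis s V d u \<and>
      eigenvalues s d u A (\<lambda>i. (-1) ^ i * (of_nat d / 2 - of_nat i) * c) \<and>
      represents s d u As (tridiag (\<lambda>_. 1) (\<lambda>j. of_nat j * of_nat (Suc d - j) / (4 * \<zeta> * \<zeta>e)))"
proof -
  have lt: "leonard_triple s V A As Ae" and bip: "bipartite_in_standard_bases s V A {As, Ae}"
    using triple unfolding totally_bipartite_leonard_triple_def by auto
  then interpret vector_space s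
    by (simp add: leonard_triple_def fin_dim_space_def)
  show "anticommuting_maps s V A As Ae \<zeta> \<zeta>s \<zeta>e"
    using lt rel by unfold_locales (auto simp: leonard_triple_def fin_dim_space_def)
  then interpret anticommuting_maps s V A As Ae \<zeta> \<zeta>s \<zeta>e .
  obtain v w where v: "standard_basis s V A {As, Ae} v" and w: "standard_basis s V As {Ae, A} w"
    using lt unfolding leonard_triple_def by blast
  obtain \<theta> where \<theta>: "eigenvalues s d v A \<theta>"
    using standard_basis_eigenvalues[OF v] d(1) by blast
  obtain B where B: "is_basis s V d v" "represents s d v As B" "irreducible_tridiagonal d B"
    using v d(1) unfolding standard_basis_def by blast
  have inj: "inj_on \<theta> {..d}"
    using standard_basis_eigenvalues_inj[OF v _ w _ linear_A] \<theta> d(1) by blast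
  have diag: "B i i = 0" if "i \<le> d" for i
    using bip v B(2) d(1) that unfolding bipartite_in_standard_bases_def bipartite_def by blast
  note par = bipartite_parameters[OF B(1) \<theta> B(2,3) inj d(2) diag]
  show "even d" "\<zeta> \<noteq> 0" using par(2,3) by simp_all
  show "\<zeta>s \<noteq> 0" "\<zeta>e \<noteq> 0" using par(1) by auto
  show "\<exists>u. is_basis s V d u \<and>
      eigenvalues s d u A (\<lambda>i. (-1) ^ i * (of_nat d / 2 - of_nat i) * c) \<and>
      represents s d u As (tridiag (\<lambda>_. 1) (\<lambda>j. of_nat j * of_nat (Suc d - j) / (4 * \<zeta> * \<zeta>e)))"
    if "\<zeta>s * \<zeta>e * c\<^sup>2 = 1" for c
    using normal_form[OF B(1) \<theta> B(2,3) inj d(2) diag that] by blast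
qed

lemma totally_bipartite_triple_unique:
  fixes s :: "'k::{alg_closed_field, field_char_0} \<Rightarrow> 'v::ab_group_add \<Rightarrow> 'v"
    and t :: "'k \<Rightarrow> 'w::ab_group_add \<Rightarrow> 'w"
  assumes V: "totally_bipartite_leonard_triple s V A As Ae"
    "anticommutator_relations s V \<zeta> \<zeta>s \<zeta>e A As Ae" "diameter s V = d"
    and W: "totally_bipartite_leonard_triple t W B Bs Be"
    "anticommutator_relations t W \<zeta> \<zeta>s \<zeta>e B Bs Be" "diameter t W = d"
    and d: "1 \<le> d"
  shows "leonard_triple_iso s V A As Ae t W B Bs Be"
proof -
  note V' = totally_bipartite_triple_structure[OF V d]
  note W' = totally_bipartite_triple_structure[OF W d]
  interpret V: anticommuting_maps s V A As Ae \<zeta> \<zeta>s \<zeta>e by (rule V'(1))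
  interpret W: anticommuting_maps t W B Bs Be \<zeta> \<zeta>s \<zeta>e by (rule W'(1))
  \<comment> \<open>A common root gives equal matrices for the first two maps of both triples, and
    \<open>represents_Ae\<close> then gives equal matrices for the third.\<close>
  obtain c where "c\<^sup>2 = 1 / (\<zeta>s * \<zeta>e)"
    using nth_root_exists[of 2] by auto
  then have c: "\<zeta>s * \<zeta>e * c\<^sup>2 = 1"
    using V'(4,5) by simp
  obtain v where v: "is_basis s V d v"
    "eigenvalues s d v A (\<lambda>i. (-1) ^ i * (of_nat d / 2 - of_nat i) * c)"
    "represents s d v As (tridiag (\<lambda>_. 1) (\<lambda>j. of_nat j * of_nat (Suc d - j) / (4 * \<zeta> * \<zeta>e)))"
    using V'(6)[OF c] by blast
  obtain w where w: "is_basis t W d w"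
    "eigenvalues t d w B (\<lambda>i. (-1) ^ i * (of_nat d / 2 - of_nat i) * c)"
    "represents t d w Bs (tridiag (\<lambda>_. 1) (\<lambda>j. of_nat j * of_nat (Suc d - j) / (4 * \<zeta> * \<zeta>e)))"
    using W'(6)[OF c] by blast
  show ?thesis
    by (rule leonard_triple_iso_if_same_matrices[OF V.vector_space_axioms W.vector_space_axioms v(1) w(1)
          V.linear_A v(2)[unfolded V.eigenvalues_iff_represents]
          W.linear_A w(2)[unfolded W.eigenvalues_iff_represents]
          V.linear_As v(3) W.linear_As w(3)
          V.linear_Ae V.represents_Ae[OF v] W.linear_Ae W.represents_Ae[OF w]])
qed

text \<open>Existence is asserted in the sequence space, which contains a copy of every
  finite-dimensional space. Necessity is repeated, and uniqueness stated, for arbitrary ambient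
  spaces.\<close>

theorem theorem9p6:
  fixes d :: nat
    and \<zeta> \<zeta>s \<zeta>e :: "'k::{alg_closed_field, field_char_0}"
    and s :: "'k \<Rightarrow> 'v::ab_group_add \<Rightarrow> 'v"
    and t :: "'k \<Rightarrow> 'w::ab_group_add \<Rightarrow> 'w"
  assumes "3 \<le> d"
  shows
    "((\<exists>(V :: (nat \<Rightarrow> 'k) set) A As Ae.
        totally_bipartite_leonard_triple seq_scale V A As Ae \<and>
        leonard_triple_bannai_ito seq_scale V A As Ae \<and>
        diameter seq_scale V = d \<and>
        anticommutator_relations seq_scale V \<zeta> \<zeta>s \<zeta>e A As Ae)
      \<longleftrightarrow> even d \<and> \<zeta> \<noteq> 0 \<and> \<zeta>s \<noteq> 0 \<and> \<zeta>e \<noteq> 0) \<and>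
     ((\<exists>(V :: 'v set) A As Ae.
        totally_bipartite_leonard_triple s V A As Ae \<and>
        leonard_triple_bannai_ito s V A As Ae \<and>
        diameter s V = d \<and>
        anticommutator_relations s V \<zeta> \<zeta>s \<zeta>e A As Ae)
      \<longrightarrow> even d \<and> \<zeta> \<noteq> 0 \<and> \<zeta>s \<noteq> 0 \<and> \<zeta>e \<noteq> 0) \<and>
     (\<forall>(V :: 'v set) A As Ae (W :: 'w set) B Bs Be.
        totally_bipartite_leonard_triple s V A As Ae \<and>
        leonard_triple_bannai_ito s V A As Ae \<and>
        diameter s V = d \<and>
        anticommutator_relations s V \<zeta> \<zeta>s \<zeta>e A As Ae \<and>
        totally_bipartite_leonard_triple t W B Bs Be \<and>
        leonard_triple_bannai_ito t W B Bs Be \<and>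
        diameter t W = d \<and>
        anticommutator_relations t W \<zeta> \<zeta>s \<zeta>e B Bs Be
      \<longrightarrow> leonard_triple_iso s V A As Ae t W B Bs Be)"
proof (intro conjI iffI impI allI)
  assume "\<exists>(V :: (nat \<Rightarrow> 'k) set) A As Ae.
        totally_bipartite_leonard_triple seq_scale V A As Ae \<and>
        leonard_triple_bannai_ito seq_scale V A As Ae \<and>
        diameter seq_scale V = d \<and>
        anticommutator_relations seq_scale V \<zeta> \<zeta>s \<zeta>e A As Ae"
  then obtain V :: "(nat \<Rightarrow> 'k) set" and A As Ae where
    V: "totally_bipartite_leonard_triple seq_scale V A As Ae"
    "anticommutator_relations seq_scale V \<zeta> \<zeta>s \<zeta>e A As Ae" "diameter seq_scale V = d"
    by blast
  have "1 \<le> d" using assms by simp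
  then show "even d" "\<zeta> \<noteq> 0" "\<zeta>s \<noteq> 0" "\<zeta>e \<noteq> 0"
    using totally_bipartite_triple_structure(2-5)[OF V] by blast+
next
  assume "\<exists>(V :: 'v set) A As Ae.
        totally_bipartite_leonard_triple s V A As Ae \<and>
        leonard_triple_bannai_ito s V A As Ae \<and>
        diameter s V = d \<and>
        anticommutator_relations s V \<zeta> \<zeta>s \<zeta>e A As Ae"
  then obtain V :: "'v set" and A As Ae where
    V: "totally_bipartite_leonard_triple s V A As Ae"
    "anticommutator_relations s V \<zeta> \<zeta>s \<zeta>e A As Ae" "diameter s V = d"
    by blast
  have "1 \<le> d" using assms by simp
  then show "even d" "\<zeta> \<noteq> 0" "\<zeta>s \<noteq> 0" "\<zeta>e \<noteq> 0"
    using totally_bipartite_triple_structure(2-5)[OF V] by blast+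
next
  assume *: "even d \<and> \<zeta> \<noteq> 0 \<and> \<zeta>s \<noteq> 0 \<and> \<zeta>e \<noteq> 0"
  \<comment> \<open>The roots exist by algebraic closure; as the scalars are nonzero, they satisfy
    the two equations assumed by the model.\<close>
  obtain c where "c\<^sup>2 = 1 / (\<zeta>s * \<zeta>e)"
    using nth_root_exists[of 2] by auto
  moreover obtain \<nu> where "\<nu>\<^sup>2 = 1 / (\<zeta> * \<zeta>e)"
    using nth_root_exists[of 2] by auto
  ultimately interpret K: krawtchouk_model d \<zeta> \<zeta>s \<zeta>e c \<nu>
    using * by unfold_locales simp_all
  show "\<exists>(V :: (nat \<Rightarrow> 'k) set) A As Ae.
        totally_bipartite_leonard_triple seq_scale V A As Ae \<and>
        leonard_triple_bannai_ito seq_scale V A As Ae \<and>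
        diameter seq_scale V = d \<and>
        anticommutator_relations seq_scale V \<zeta> \<zeta>s \<zeta>e A As Ae"
    using K.totally_bipartite_bannai_ito K.relations * assms
    by (intro exI[of _ K.V] exI[of _ K.A] exI[of _ K.As] exI[of _ K.Ae]) simp
next
  fix V :: "'v set" and A As Ae and W :: "'w set" and B Bs Be
  assume "totally_bipartite_leonard_triple s V A As Ae \<and>
        leonard_triple_bannai_ito s V A As Ae \<and>
        diameter s V = d \<and>
        anticommutator_relations s V \<zeta> \<zeta>s \<zeta>e A As Ae \<and>
        totally_bipartite_leonard_triple t W B Bs Be \<and>
        leonard_triple_bannai_ito t W B Bs Be \<and>
        diameter t W = d \<and>
        anticommutator_relations t W \<zeta> \<zeta>s \<zeta>e B Bs Be"
  then show "leonard_triple_iso s V A As Ae t W B Bs Be"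
    using assms
    by (intro totally_bipartite_triple_unique[of s V A As Ae \<zeta> \<zeta>s \<zeta>e d t W B Bs Be]) simp_all
qed

end
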